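(* Let $\mathcal{L}(s)=\sum_{i=1}^K\mathcal{L}_i(s)$ be a piecewise continuous time-dependent Liouvillian that is a sum of $K$ strictly $k$-local terms on a finite lattice, and let $t\ge0$. With $T_{\mathcal{L}}$, $T_i^j$, $\beta$, $t^{\mathrm{ID}}$, $\tilde C$ as defined in the context, suppose $$0<\epsilon\le\frac{2K^2\beta t\,\ln(2)\,e^{(K+K^2)t^{\mathrm{ID}}\beta}}{3+[3+\tilde C]K+\tilde CK^2}.$$ Then, for every positive integer $m$ with $$m\ge\frac{2K^2\beta^2t^2e^{(K+K^2)t^{\mathrm{ID}}\beta}}{\epsilon},$$ one has $$\Big\|T_{\mathcal{L}}(t,0)-\prod_{j=1}^m\prod_{i=1}^KT_i^j\Big\|_{1\to1}\le\epsilon .$$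
   Context: Setting. $\Lambda$ is a finite lattice with $N$ sites; $\mathcal{H}=\bigotimes_{x\in\Lambda}\mathcal{H}_x$ with $\mathcal{H}_x\simeq\mathbb{C}^d$; $\mathcal{B}(\mathcal{H})$ is the space of linear operators on $\mathcal{H}$ and $\mathcal{B}(\mathcal{B}(\mathcal{H}))$ the space of superoperators. The Liouvillian $\mathcal{L}:\mathbb{R}^+\to\mathcal{B}(\mathcal{B}(\mathcal{H}))$ is piecewise continuous and $\mathcal{L}(s)=\sum_{i=1}^K\mathcal{L}_i(s)$, where each $\mathcal{L}_i:\mathbb{R}^+\to\mathcal{B}(\mathcal{B}(\mathcal{H}))$ is piecewise continuous and strictly $k$-local: it acts non-trivially on at most $k$ sites, i.e. there is $Z_i\subset\Lambda$, $|Z_i|\le k$, such that $\mathcal{L}_i(s)$ is a superoperator on $\mathcal{B}(\mathcal{H}_{Z_i})$ tensored with the identity superoperator on the remaining sites. The number of non-trivial terms is $K\le N^k$. The $\mathcal{L}_i$ are not assumed to be of GKSL form with non-negative rates. Propagators. For a piecewise continuous superoperator-valued function $\mathcal{M}$, $T_{\mathcal{M}}(t,s)$ ($t\ge s\ge0$) is the unique solution of $\frac{d}{dt}T_{\mathcal{M}}(t,s)=\mathcal{M}(t)T_{\mathcal{M}}(t,s)$, $T_{\mathcal{M}}(s,s)=\mathds{1}$. For fixed $t$ and $m$, $T_i^j:=T_{\mathcal{L}_i}(tj/m,t(j-1)/m)$ for $1\le i\le K$, $1\le j\le m$. Products are ordered with larger index to the left: $\prod_{j=1}^mX^j=X^m\cdots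 X^1$. Norms. $\|A\|_1=\mathrm{tr}|A|$ for operators and $\|T\|_{1\to1}=\sup_{\|A\|_1=1}\|T(A)\|_1$ for superoperators. Indivisibility quantities. $\mathrm{Ch}(T)=0$ if $T$ is a quantum channel (completely positive and trace preserving), and $\mathrm{Ch}(T)=1$ otherwise. $\tilde N_i^m=\sum_{j=1}^m\mathrm{Ch}(T_i^j)$. $t_i^{\mathrm{ID}}=\lim_{m\to\infty}\tilde N_i^m\,t/m$ and $t^{\mathrm{ID}}=\max_{1\le i\le K}t_i^{\mathrm{ID}}$. $C_i^m$ is the number of $j\in\{1,\dots,m-1\}$ with $\mathrm{Ch}(T_i^j)=0$ and $\mathrm{Ch}(T_i^{j+1})=1$; $C_i=\lim_{m\to\infty}C_i^m$; $\tilde C=2\max_{1\le i\le K}C_i$ (these limits are taken to exist). Finally $\beta=\sup_{0\le s\le t}\max_{1\le i\le K}\|\mathcal{L}_i(s)\|_{1\to1}$. *)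

theory Defs
  imports "HOL-Analysis.Analysis"
begin

text \<open>
  Operators on a finite-dimensional Hilbert space with orthonormal basis indexed by \<open>'n\<close> are
  complex square matrices. The type of superoperators below consists of the real-linear maps
  on operators; complex linearity is the separate predicate \<open>complex_linear\<close>.
  A vector type is chosen because it carries the (unique) topology of the finite-dimensional space
  of superoperators, which continuity and derivatives in time refer to.
\<close>

type_synonym 'n oper = "complex ^ 'n ^ 'n"
type_synonym 'n superop = "'n oper \<Rightarrow>\<^sub>L 'n oper"

definition cscale :: "complex \<Rightarrow> 'n::finite oper \<Rightarrow> 'n oper" where
  "cscale c A = (\<chi> i j. c * A $ i $ j)"

definition complex_linear :: "'n::finite superop \<Rightarrow> bool" where
  "complex_linear T \<longleftrightarrow> (\<forall>c A. blinfun_apply T (cscale c A) = cscale c (blinfun_apply T A))"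

definition cinner :: "complex ^ 'n::finite \<Rightarrow> complex ^ 'n \<Rightarrow> complex" where
  "cinner v w = (\<Sum>i\<in>UNIV. cnj (v $ i) * w $ i)"

definition dagger :: "'n::finite oper \<Rightarrow> 'n oper" where
  "dagger A = (\<chi> i j. cnj (A $ j $ i))"

definition positive_op :: "'n::finite oper \<Rightarrow> bool" where
  "positive_op A \<longleftrightarrow> (\<forall>v. cinner v (A *v v) \<in> \<real>\<^sub>\<ge>\<^sub>0)"

definition abs_op :: "'n::finite oper \<Rightarrow> 'n oper" where
  "abs_op A = (THE P. positive_op P \<and> P ** P = dagger A ** A)"

definition trace_norm :: "'n::finite oper \<Rightarrow> real" where
  "trace_norm A = Re (trace (abs_op A))"

definition norm_1to1 :: "'n::finite superop \<Rightarrow> real" where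
  "norm_1to1 T = (SUP A\<in>{A. trace_norm A = 1}. trace_norm (blinfun_apply T A))"

text \<open>
  An operator on \<open>\<complex>\<^sup>n\<close> tensored with the given space is an \<open>n\<close> by \<open>n\<close> array of blocks
  \<open>X p q\<close>, on which the identity tensored with \<open>T\<close> acts blockwise.
\<close>

definition positive_block_op :: "nat \<Rightarrow> (nat \<Rightarrow> nat \<Rightarrow> 'n::finite oper) \<Rightarrow> bool" where
  "positive_block_op n X \<longleftrightarrow>
     (\<forall>v. (\<Sum>p<n. \<Sum>q<n. cinner (v p) (X p q *v v q)) \<in> \<real>\<^sub>\<ge>\<^sub>0)"

definition completely_positive :: "'n::finite superop \<Rightarrow> bool" where
  "completely_positive T \<longleftrightarrow>
     (\<forall>n X. positive_block_op n X \<longrightarrow> positive_block_op n (\<lambda>p q. blinfun_apply T (X p q)))"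

definition trace_preserving :: "'n::finite superop \<Rightarrow> bool" where
  "trace_preserving T \<longleftrightarrow> (\<forall>A. trace (blinfun_apply T A) = trace A)"

definition quantum_channel :: "'n::finite superop \<Rightarrow> bool" where
  "quantum_channel T \<longleftrightarrow> complex_linear T \<and> completely_positive T \<and> trace_preserving T"

text \<open>
  For a lattice \<open>'x\<close> and local dimension \<open>CARD('d)\<close>, the product basis of the tensor product of
  the site spaces is indexed by the configurations \<open>'x \<Rightarrow> 'd\<close>; the product basis for the sites in
  \<open>Z\<close> is indexed by the extensional functions \<open>Z \<rightarrow>\<^sub>E UNIV\<close>. In \<open>acts_on Z T\<close>, the family \<open>m\<close> consists
  of the matrix elements of a superoperator on the sites \<open>Z\<close>,
  \<open>M(X)\<^bsub>a b\<^esub> = (\<Sum>c d. m a b c d * X\<^bsub>c d\<^esub>)\<close>, and the equation says that \<open>T\<close> is \<open>M\<close> tensored with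
  the identity superoperator on the other sites.
\<close>

definition acts_on :: "'x set \<Rightarrow> ('x::finite \<Rightarrow> 'd::finite) superop \<Rightarrow> bool" where
  "acts_on Z T \<longleftrightarrow> complex_linear T \<and>
     (\<exists>m. \<forall>A a b. blinfun_apply T A $ a $ b =
        (\<Sum>c\<in>Z \<rightarrow>\<^sub>E UNIV. \<Sum>d\<in>Z \<rightarrow>\<^sub>E UNIV.
           m (restrict a Z) (restrict b Z) c d * A $ override_on a c Z $ override_on b d Z))"

definition strictly_local :: "nat \<Rightarrow> (real \<Rightarrow> ('x::finite \<Rightarrow> 'd::finite) superop) \<Rightarrow> bool" where
  "strictly_local k M \<longleftrightarrow> (\<exists>Z. card Z \<le> k \<and> (\<forall>s\<ge>0. acts_on Z (M s)))"

text \<open>Functions of time are only considered on the half-line of nonnegative reals.\<close>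

definition piecewise_continuous :: "(real \<Rightarrow> 'a::topological_space) \<Rightarrow> bool" where
  "piecewise_continuous f \<longleftrightarrow>
     (\<forall>b. finite {s \<in> {0..b}. \<not> continuous (at s within {0..}) f}) \<and>
     (\<forall>s\<ge>0. \<exists>l. (f \<longlongrightarrow> l) (at_right s)) \<and>
     (\<forall>s>0. \<exists>l. (f \<longlongrightarrow> l) (at_left s))"

text \<open>
  For a piecewise continuous generator, a solution of the evolution equation is continuous and
  satisfies the differential equation wherever the generator is continuous.
\<close>

definition solves_evolution ::
  "(real \<Rightarrow> 'n::finite superop) \<Rightarrow> real \<Rightarrow> (real \<Rightarrow> 'n superop) \<Rightarrow> bool" where
  "solves_evolution M s U \<longleftrightarrow>
     U s = id_blinfun \<and> continuous_on {s..} U \<and>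
     (\<forall>r\<ge>s. continuous (at r within {0..}) M \<longrightarrow>
        (U has_vector_derivative (M r o\<^sub>L U r)) (at r within {s..}))"

text \<open>
  The value at \<open>t\<close> of the solution started at \<open>s\<close>, for \<open>0 \<le> s \<le> t\<close>. The definite description is
  taken over values because the solution is unique only on \<open>{s..}\<close>.
\<close>

definition propagator :: "(real \<Rightarrow> 'n::finite superop) \<Rightarrow> real \<Rightarrow> real \<Rightarrow> 'n superop" where
  "propagator M t s = (THE V. \<exists>U. solves_evolution M s U \<and> V = U t)"

definition step_prop ::
  "(nat \<Rightarrow> real \<Rightarrow> 'n::finite superop) \<Rightarrow> real \<Rightarrow> nat \<Rightarrow> nat \<Rightarrow> nat \<Rightarrow> 'n superop" where
  "step_prop Li t m i j =
     propagator (Li i) (t * real j / real m) (t * (real j - 1) / real m)"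

text \<open>\<open>ordered_prod X n\<close> is \<open>X n \<cdots> X 1\<close>, with larger indices to the left.\<close>

primrec ordered_prod :: "(nat \<Rightarrow> 'n::finite superop) \<Rightarrow> nat \<Rightarrow> 'n superop" where
  "ordered_prod X 0 = id_blinfun"
| "ordered_prod X (Suc n) = X (Suc n) o\<^sub>L ordered_prod X n"

definition Ch :: "'n::finite superop \<Rightarrow> nat" where
  "Ch T = (if quantum_channel T then 0 else 1)"

definition N_indiv ::
  "(nat \<Rightarrow> real \<Rightarrow> 'n::finite superop) \<Rightarrow> real \<Rightarrow> nat \<Rightarrow> nat \<Rightarrow> nat" where
  "N_indiv Li t i m = (\<Sum>j=1..m. Ch (step_prop Li t m i j))"

definition t_ID_seq ::
  "(nat \<Rightarrow> real \<Rightarrow> 'n::finite superop) \<Rightarrow> real \<Rightarrow> nat \<Rightarrow> nat \<Rightarrow> real" where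
  "t_ID_seq Li t i m = real (N_indiv Li t i m) * t / real m"

definition t_ID :: "nat \<Rightarrow> (nat \<Rightarrow> real \<Rightarrow> 'n::finite superop) \<Rightarrow> real \<Rightarrow> real" where
  "t_ID K Li t = (MAX i\<in>{1..K}. lim (t_ID_seq Li t i))"

definition C_count ::
  "(nat \<Rightarrow> real \<Rightarrow> 'n::finite superop) \<Rightarrow> real \<Rightarrow> nat \<Rightarrow> nat \<Rightarrow> real" where
  "C_count Li t i m = real (card {j \<in> {1..m-1}.
     Ch (step_prop Li t m i j) = 0 \<and> Ch (step_prop Li t m i (j + 1)) = 1})"

definition C_tilde :: "nat \<Rightarrow> (nat \<Rightarrow> real \<Rightarrow> 'n::finite superop) \<Rightarrow> real \<Rightarrow> real" where
  "C_tilde K Li t = 2 * (MAX i\<in>{1..K}. lim (C_count Li t i))"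

definition beta :: "nat \<Rightarrow> (nat \<Rightarrow> real \<Rightarrow> 'n::finite superop) \<Rightarrow> real \<Rightarrow> real" where
  "beta K Li t = (SUP s\<in>{0..t}. MAX i\<in>{1..K}. norm_1to1 (Li i s))"

end

theory Submission
  imports Defs
begin

text \<open>
  With \<open>\<delta> = \<beta> t / m\<close>, each step propagator and each Trotter step agree to second order in \<open>\<delta>\<close>, with
  error at most \<open>(K \<delta>)\<^sup>2 exp (K \<delta>)\<close>. The errors of the \<open>m\<close> steps add up, each multiplied by Trotter
  steps to its left and by \<open>T\<^sub>L(t l / m, 0)\<close> to its right. Quantum channels are contractions for the
  trace norm, so each Trotter step has norm at most \<open>exp (\<delta> r)\<close> with \<open>r\<close> the number of its factors that
  are not channels; the same estimate for arbitrarily fine Trotter products bounds the propagator of \<open>L\<close>.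
  A coarse step that is not a channel contains a fine step that is not one, so the total number of such
  steps at level \<open>m\<close> exceeds \<open>m t\<^sup>I\<^sup>D / t\<close> by at most \<open>2 C\<^sub>i + 1\<close> for each \<open>i\<close>.

  The trace norm of \<open>X\<close> is the maximum of \<open>Re (tr (V X))\<close> over unitary \<open>V\<close>: at a maximiser, varying \<open>V\<close>
  by reflections shows that \<open>V X\<close> is positive, hence it is the absolute value of \<open>X\<close>.
\<close>

section \<open>Positive operators and unitary operators\<close>

text \<open>The obstacle is the factor \<open>propagator L\<close> to the right of each error. The
  crude bound exp (K beta t) would put t into the exponent where only \<open>t_ID\<close> is
  allowed, and the counts of indivisible steps concern the terms \<open>Li i\<close>, not their sum.
  Its norm is therefore read off from Trotter products on a grid of m n steps, with n tending to
  infinity. The same limit removes a second difficulty: \<open>t_ID\<close> and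
  \<open>C_tilde\<close> are limits and do not control the counts at the given m. Coarse steps to
  the left of an error and fine steps to its right are counted together, so that the indivisible
  time in [0, t] enters the exponent once and not twice. Constants: with T = \<open>t_ID\<close> and
  C = \<open>C_tilde\<close>, the m errors sum to at most m (K \<delta>)^2 exp (K beta T) exp (K (C
  + 2) \<delta>). The hypotheses on \<epsilon> and m combine to D \<delta> \<le> ln 2, where D is
  the denominator in the bound on \<epsilon>. As D dominates K (C + 2), the last factor is at most
  2, which is the 2 in the lower bound on m.\<close>

lemma dagger_nth [simp]: "dagger A $ i $ j = cnj (A $ j $ i)"
  by (simp add: dagger_def)

lemma dagger_dagger [simp]: "dagger (dagger A) = A"
  by (simp add: vec_eq_iff)

lemma dagger_mult: "dagger (A ** B) = dagger B ** dagger A"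
  by (simp add: vec_eq_iff matrix_matrix_mult_def mult.commute)

lemma dagger_diff: "dagger (A - B) = dagger A - dagger B"
  by (simp add: vec_eq_iff)

lemma oper_add_rdistrib: "(A + B) ** C = A ** C + B ** C"
  for A B C :: "complex ^ 'n::finite ^ 'n"
  by (simp add: vec_eq_iff matrix_matrix_mult_def sum.distrib distrib_right)

lemma matrix_sub_rdistrib: "(A - B) ** C = A ** C - B ** C"
  for A B C :: "complex ^ 'n::finite ^ 'n"
  by (simp add: vec_eq_iff matrix_matrix_mult_def sum_subtractf left_diff_distrib)

lemma matrix_sub_ldistrib: "C ** (A - B) = C ** A - C ** B"
  for A B C :: "complex ^ 'n::finite ^ 'n"
  by (simp add: vec_eq_iff matrix_matrix_mult_def sum_subtractf right_diff_distrib)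

lemma cinner_add_left: "cinner (u + v) w = cinner u w + cinner v w"
  by (simp add: cinner_def sum.distrib distrib_right)

lemma cinner_add_right: "cinner w (u + v) = cinner w u + cinner w v"
  by (simp add: cinner_def sum.distrib distrib_left)

lemma cinner_scale_left: "cinner (c *s u) w = cnj c * cinner u w"
  by (simp add: cinner_def sum_distrib_left mult.assoc)

lemma cinner_scale_right: "cinner w (c *s u) = c * cinner w u"
  by (simp add: cinner_def sum_distrib_left mult_ac)

lemma cinner_minus_left: "cinner (- u) w = - cinner u w"
  by (simp add: cinner_def sum_negf)

lemma cinner_minus_right: "cinner w (- u) = - cinner w u"
  by (simp add: cinner_def sum_negf)

lemma matrix_vector_mult_minus_right: "A *v (- w) = - (A *v w)" for A :: "complex ^ 'n::finite ^ 'm"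
  by (simp add: vec_eq_iff matrix_vector_mult_def sum_negf)

lemma cinner_zero_left [simp]: "cinner 0 w = 0"
  by (simp add: cinner_def)

lemma cinner_zero_right [simp]: "cinner w 0 = 0"
  by (simp add: cinner_def)

lemma cinner_self: "cinner v v = of_real (\<Sum>i\<in>UNIV. (cmod (v $ i))\<^sup>2)"
  by (simp add: cinner_def complex_norm_square mult.commute del: of_real_power)

lemma cinner_self_eq_0_iff [simp]: "cinner v v = 0 \<longleftrightarrow> v = 0"
  by (simp add: cinner_self sum_nonneg_eq_0_iff vec_eq_iff del: of_real_sum)

lemma cinner_matrix_right: "cinner v (A *v w) = cinner (dagger A *v v) w"
proof -
  have "cinner v (A *v w) = (\<Sum>i\<in>UNIV. \<Sum>j\<in>UNIV. cnj (v $ i) * (A $ i $ j * w $ j))"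
    by (simp add: cinner_def matrix_vector_mult_def sum_distrib_left)
  also have "\<dots> = (\<Sum>j\<in>UNIV. \<Sum>i\<in>UNIV. cnj (v $ i) * (A $ i $ j * w $ j))"
    by (rule sum.swap)
  also have "\<dots> = cinner (dagger A *v v) w"
    by (simp add: cinner_def matrix_vector_mult_def sum_distrib_left mult_ac)
  finally show ?thesis .
qed

lemma cinner_axis_left [simp]: "cinner (axis k 1) w = w $ k"
proof -
  have "cinner (axis k 1) w = (\<Sum>i\<in>UNIV. if i = k then w $ i else 0)"
    unfolding cinner_def by (intro sum.cong) (auto simp: axis_def)
  then show ?thesis by simp
qed

lemma matrix_mult_axis_nth [simp]: "(A *v axis k 1) $ i = A $ i $ k" for A :: "complex ^ 'n::finite ^ 'm"
proof -
  have "(A *v axis k 1) $ i = (\<Sum>j\<in>UNIV. if j = k then A $ i $ j else 0)"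
    by (simp only: matrix_vector_mult_def vec_lambda_beta, intro sum.cong) (auto simp: axis_def)
  then show ?thesis by simp
qed

lemma matrix_eq_axisI:
  fixes A B :: "complex ^ 'n::finite ^ 'm"
  assumes "\<And>k. A *v axis k 1 = B *v axis k 1"
  shows "A = B"
  using assms by (metis (no_types, lifting) matrix_mult_axis_nth vec_eq_iff)

lemma trace_eq_sum_cinner: "trace A = (\<Sum>k\<in>UNIV. cinner (axis k 1) (A *v axis k 1))"
  by (simp add: trace_def)

lemma eq_neg_self: "z = - z \<Longrightarrow> z = 0" for z :: complex
  by (simp add: complex_eq_iff)

text \<open>Polarization in scalar form: p and q are the two cross terms of a real-valued form,
  tested with the coefficients 1 and \<i>.\<close>

lemma eq_cnjI: "Im (p + q) = 0 \<Longrightarrow> Im (\<i> * p - \<i> * q) = 0 \<Longrightarrow> q = cnj p"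
  by (simp add: complex_eq_iff)

text \<open>A form that is real on all vectors is Hermitian: the test vectors are e_i + c e_j with c
  = 1 and c = \<i>.\<close>

lemma positive_op_hermitian:
  assumes "positive_op A"
  shows "dagger A = A"
proof -
  have "A $ j $ i = cnj (A $ i $ j)" for i j
  proof (rule eq_cnjI)
    have im: "Im (cinner v (A *v v)) = 0" for v
      using assms by (auto simp: positive_op_def complex_nonneg_Reals_iff)
    have ax: "Im (A $ k $ k) = 0" for k
      using im[of "axis k 1"] by simp
    have *: "Im (A $ i $ i + c * A $ i $ j + cnj c * A $ j $ i + cnj c * c * A $ j $ j) = 0" for c
    proof -
      let ?v = "axis i 1 + c *s axis j 1"
      have "cinner ?v (A *v ?v) = A $ i $ i + c * A $ i $ j + cnj c * A $ j $ i + cnj c * c * A $ j $ j"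
        by (simp add: cinner_add_left cinner_scale_left matrix_vector_right_distrib
            vector_scalar_commute distrib_left)
      then show ?thesis using im[of ?v] by simp
    qed
    show "Im (A $ i $ j + A $ j $ i) = 0" using *[of 1] ax[of i] ax[of j] by simp
    show "Im (\<i> * A $ i $ j - \<i> * A $ j $ i) = 0" using *[of "\<i>"] ax[of i] ax[of j] by simp
  qed
  then show ?thesis unfolding vec_eq_iff dagger_nth by metis
qed

text \<open>With w = A v, the form at v + s w equals 2 s |w|^2 + s^2 b for real s, because its value
  at v vanishes. For small negative s this would be negative unless w = 0.\<close>

lemma positive_op_null:
  assumes "positive_op A" "cinner v (A *v v) = 0"
  shows "A *v v = 0"
proof -
  define w where "w = A *v v"
  define n where "n = Re (cinner w w)"
  define b where "b = Re (cinner w (A *v w))"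
  have b: "0 \<le> b" using assms(1) by (auto simp: b_def positive_op_def complex_nonneg_Reals_iff)
  have wv: "cinner v (A *v w) = cinner w w"
    by (metis assms(1) cinner_matrix_right positive_op_hermitian w_def)
  have pos: "0 \<le> 2 * s * n + s\<^sup>2 * b" for s :: real
  proof -
    have "0 \<le> Re (cinner (v + of_real s *s w) (A *v (v + of_real s *s w)))"
      using assms(1) by (auto simp: positive_op_def complex_nonneg_Reals_iff)
    also have "cinner (v + of_real s *s w) (A *v (v + of_real s *s w)) =
        2 * of_real s * cinner w w + (of_real s)\<^sup>2 * cinner w (A *v w)"
      using assms(2) wv
      by (simp add: matrix_vector_right_distrib vector_scalar_commute cinner_add_left
          cinner_add_right cinner_scale_left cinner_scale_right w_def[symmetric] algebra_simps
          power2_eq_square)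
    finally show ?thesis by (simp add: n_def b_def power2_eq_square)
  qed
  have n0: "n \<ge> 0" by (simp add: n_def cinner_self sum_nonneg)
  have "n = 0"
  proof (rule ccontr)
    assume "n \<noteq> 0"
    then have "n > 0" using n0 by simp
    \<comment> \<open>The choice s = - n / (b + 1) is close to the minimiser - n / b; the summand 1
      admits b = 0.\<close>
    have "0 \<le> 2 * (- n / (b + 1)) * n + (- n / (b + 1))\<^sup>2 * b" by (rule pos)
    also have "\<dots> = - (n\<^sup>2 * (b + 2)) / (b + 1)\<^sup>2"
      using b by (simp add: divide_simps power2_eq_square) (simp add: algebra_simps)
    also have "\<dots> < 0" using b \<open>n > 0\<close> by (simp add: divide_simps)
    finally show False by simp
  qed
  then have "cinner w w = 0"
    by (simp add: n_def cinner_self complex_eq_iff)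
  then show ?thesis by (simp add: w_def)
qed

lemma Re_trace_nonneg: "positive_op A \<Longrightarrow> 0 \<le> Re (trace A)"
  unfolding trace_eq_sum_cinner Re_sum positive_op_def complex_nonneg_Reals_iff
  by (intro sum_nonneg) blast

lemma cinner_conjugate: "cinner v ((dagger B ** A ** B) *v v) = cinner (B *v v) (A *v (B *v v))"
  by (simp add: matrix_vector_mul_assoc[symmetric] cinner_matrix_right[of v "dagger B"])

lemma positive_op_conjugate: "positive_op A \<Longrightarrow> positive_op (dagger B ** A ** B)"
  by (simp add: positive_op_def cinner_conjugate)

text \<open>The trace is a sum of the nonnegative values of the form of A at the columns of B, so
  each value vanishes and \<open>positive_op_null\<close> applies column by column.\<close>

lemma trace_conjugate_eq_0:
  assumes "positive_op A" "Re (trace (dagger B ** A ** B)) = 0"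
  shows "A ** B = 0"
proof (rule matrix_eq_axisI)
  fix k
  have "positive_op (dagger B ** A ** B)" by (rule positive_op_conjugate) fact
  then have *: "0 \<le> Re (cinner (axis k 1) ((dagger B ** A ** B) *v axis k 1))"
      "Im (cinner (axis k 1) ((dagger B ** A ** B) *v axis k 1)) = 0" for k
    unfolding positive_op_def complex_nonneg_Reals_iff by blast+
  have "Re (cinner (axis k 1) ((dagger B ** A ** B) *v axis k 1)) = 0" for k
    using assms(2) *(1) unfolding trace_eq_sum_cinner Re_sum
    by (subst (asm) sum_nonneg_eq_0_iff) auto
  then have "cinner (axis k 1) ((dagger B ** A ** B) *v axis k 1) = 0"
    using *(2) by (simp add: complex_eq_iff)
  then have "cinner (B *v axis k 1) (A *v (B *v axis k 1)) = 0"
    by (simp add: cinner_conjugate)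
  then have "A *v (B *v axis k 1) = 0" by (rule positive_op_null[OF assms(1)])
  then show "(A ** B) *v axis k 1 = 0 *v axis k 1"
    by (simp add: matrix_vector_mul_assoc[symmetric])
qed

text \<open>Let D = P - Q. Equality of the squares gives D P + D Q = - (P D + Q D), so by cyclicity
  tr (D P D) + tr (D Q D) equals its own negative. Both traces are nonnegative, hence zero, which
  forces P D = Q D = 0, thus D D = 0, and D = 0 because D is Hermitian. This makes the definite
  description in \<open>abs_op\<close> well defined.\<close>

lemma positive_sqrt_unique:
  assumes P: "positive_op P" and Q: "positive_op Q" and eq: "P ** P = Q ** Q"
  shows "P = Q"
proof -
  define D where "D = P - Q"
  have hD: "dagger D = D"
    using P Q by (simp add: D_def dagger_diff positive_op_hermitian)
  have anti: "D ** P + D ** Q = - (P ** D + Q ** D)"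
    using eq by (simp add: D_def matrix_sub_rdistrib matrix_sub_ldistrib)
  have "trace (D ** P ** D) + trace (D ** Q ** D) = trace ((D ** P + D ** Q) ** D)"
    by (simp add: trace_add oper_add_rdistrib)
  also have "\<dots> = - trace (P ** D ** D) - trace (Q ** D ** D)"
  proof -
    have "trace (- X) = - trace X" for X :: "complex ^ 'a ^ 'a"
      by (simp add: trace_def sum_negf)
    moreover have "- X ** D = - (X ** D)" for X :: "complex ^ 'a ^ 'a"
      by (simp add: vec_eq_iff matrix_matrix_mult_def sum_negf)
    ultimately show ?thesis
      unfolding anti by (simp add: oper_add_rdistrib matrix_sub_rdistrib trace_add trace_sub)
  qed
  also have "\<dots> = - (trace (D ** P ** D) + trace (D ** Q ** D))"
    using trace_mul_sym[of "P ** D" D] trace_mul_sym[of "Q ** D" D] by (simp add: matrix_mul_assoc)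
  finally have "trace (D ** P ** D) + trace (D ** Q ** D) = 0"
    using eq_neg_self by blast
  then have "Re (trace (D ** P ** D)) + Re (trace (D ** Q ** D)) = 0"
    by (metis plus_complex.simps(1) zero_complex.simps(1))
  moreover have "0 \<le> Re (trace (D ** P ** D))" "0 \<le> Re (trace (D ** Q ** D))"
    using positive_op_conjugate[OF P, of D] positive_op_conjugate[OF Q, of D]
    by (auto simp: hD intro: Re_trace_nonneg)
  ultimately have "Re (trace (D ** P ** D)) = 0" "Re (trace (D ** Q ** D)) = 0" by linarith+
  then have "P ** D = 0" "Q ** D = 0"
    using trace_conjugate_eq_0[OF P, of D] trace_conjugate_eq_0[OF Q, of D] by (simp_all add: hD)
  then have DD: "D ** D = 0" by (metis D_def diff_self matrix_sub_rdistrib)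
  have "D = 0"
  proof (rule matrix_eq_axisI)
    fix k
    have "cinner (D *v axis k 1) (D *v axis k 1) = cinner (axis k 1) ((D ** D) *v axis k 1)"
      by (simp only: matrix_vector_mul_assoc[symmetric] cinner_matrix_right[of "axis k 1" D] hD)
    then have "D *v axis k 1 = 0" by (simp add: DD)
    then show "D *v axis k 1 = 0 *v axis k 1" by simp
  qed
  then show ?thesis by (simp add: D_def)
qed

section \<open>Unitary operators and the maximisation of Re (tr (V X))\<close>

definition unitary_op :: "'n::finite oper \<Rightarrow> bool" where
  "unitary_op U \<longleftrightarrow> dagger U ** U = mat 1"

lemma unitary_op_one: "unitary_op (mat 1)"
  by (simp add: unitary_op_def vec_eq_iff mat_def)
     (simp add: matrix_matrix_mult_def dagger_def if_distrib[of cnj] if_distrib[of "\<lambda>x. x * _"] cong: if_cong)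

lemma unitary_op_right: "unitary_op U \<Longrightarrow> U ** dagger U = mat 1"
  unfolding unitary_op_def using matrix_left_right_inverse by blast

lemma unitary_op_mult: "unitary_op U \<Longrightarrow> unitary_op V \<Longrightarrow> unitary_op (U ** V)"
  unfolding unitary_op_def dagger_mult
  by (metis matrix_mul_assoc matrix_mul_lid)

lemma unitary_op_entry_sum: "unitary_op U \<Longrightarrow> (\<Sum>k\<in>UNIV. (cmod (U $ k $ i))\<^sup>2) = 1"
proof -
  assume "unitary_op U"
  then have "(dagger U ** U) $ i $ i = 1" by (simp add: unitary_op_def mat_def)
  then have "of_real (\<Sum>k\<in>UNIV. (cmod (U $ k $ i))\<^sup>2) = (1::complex)"
    by (simp add: matrix_matrix_mult_def complex_norm_square mult.commute del: of_real_power)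
  then show ?thesis using of_real_eq_1_iff by blast
qed

lemma unitary_op_entry_le: 
  assumes "unitary_op U" shows "cmod (U $ k $ i) \<le> 1"
proof -
  have "(cmod (U $ k $ i))\<^sup>2 \<le> (\<Sum>k\<in>UNIV. (cmod (U $ k $ i))\<^sup>2)"
    by (rule member_le_sum) auto
  then show ?thesis
    using unitary_op_entry_sum[OF assms] by (simp add: power_le_one_iff)
qed

lemma norm_oper_le_entries: "norm (A :: 'n::finite oper) \<le> (\<Sum>i\<in>UNIV. \<Sum>j\<in>UNIV. cmod (A $ i $ j))"
proof -
  have "norm A \<le> (\<Sum>i\<in>UNIV. norm (A $ i))"
    unfolding norm_vec_def[of A] by (rule L2_set_le_sum) simp
  also have "\<dots> \<le> (\<Sum>i\<in>UNIV. \<Sum>j\<in>UNIV. cmod (A $ i $ j))"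
    by (intro sum_mono) (simp add: norm_vec_def L2_set_le_sum)
  finally show ?thesis .
qed

lemma norm_oper_entry_le: "cmod (A $ i $ j) \<le> norm (A :: 'n::finite oper)"
  by (meson Finite_Cartesian_Product.norm_nth_le order_trans)

text \<open>The columns are unit vectors, which bounds the entries, and the defining equations are
  closed conditions on the entries.\<close>

lemma compact_unitary: "compact {U :: 'n::finite oper. unitary_op U}"
  unfolding compact_eq_bounded_closed
proof
  have "norm U \<le> (\<Sum>i\<in>(UNIV::'n set). \<Sum>j\<in>(UNIV::'n set). 1)" if "unitary_op U" for U :: "'n oper"
    using that by (intro order_trans[OF norm_oper_le_entries] sum_mono) (rule unitary_op_entry_le)
  then show "bounded {U :: 'n oper. unitary_op U}" by (auto simp: bounded_iff)
  have "{U :: 'n oper. unitary_op U} =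
      {U. \<forall>i j. (\<Sum>k\<in>UNIV. cnj (U $ k $ i) * U $ k $ j) = (mat 1 :: 'n oper) $ i $ j}"
    by (simp add: unitary_op_def matrix_matrix_mult_def vec_eq_iff)
  then show "closed {U :: 'n oper. unitary_op U}"
    by (simp only:) (intro closed_Collect_all closed_Collect_eq continuous_intros)
qed

lemma trace_mult_eq: "trace (V ** X) = (\<Sum>i\<in>UNIV. \<Sum>j\<in>UNIV. V $ i $ j * X $ j $ i)"
  by (simp add: trace_def matrix_matrix_mult_def)

text \<open>V is 1 plus c times the rank-one operator of v; it fixes the complement of v and
  multiplies v by 1 + c |v|^2. The equation for c says that this number has modulus 1.\<close>

lemma reflection_unitary:
  fixes v :: "complex ^ 'n::finite"
  assumes c: "c + cnj c + cnj c * c * cinner v v = 0"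
  defines "V \<equiv> (\<chi> i j. (if i = j then 1 else 0) + c * v $ i * cnj (v $ j))"
  shows "unitary_op V"
    and "trace (V ** Y) = trace Y + c * cinner v (Y *v v)"
proof -
  have "(\<Sum>k\<in>UNIV. cnj (V $ k $ i) * V $ k $ j) = (if i = j then 1 else 0)" for i j
  proof -
    have "(\<Sum>k\<in>UNIV. cnj (V $ k $ i) * V $ k $ j) =
       (\<Sum>k\<in>UNIV. (if k = i then (if i = j then 1 else 0) else 0)
          + (if k = i then c * v $ i * cnj (v $ j) else 0)
          + (if k = j then cnj c * v $ i * cnj (v $ j) else 0)
          + cnj c * c * (v $ i * cnj (v $ j)) * (cnj (v $ k) * v $ k))"
      by (intro sum.cong refl) (auto simp: V_def algebra_simps)
    also have "\<dots> = (if i = j then 1 else 0) + c * v $ i * cnj (v $ j) + cnj c * v $ i * cnj (v $ j)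
         + cnj c * c * (v $ i * cnj (v $ j)) * cinner v v"
      by (simp add: sum.distrib cinner_def sum_distrib_left)
    also have "\<dots> = (if i = j then 1 else 0) + (c + cnj c + cnj c * c * cinner v v) * (v $ i * cnj (v $ j))"
      by (simp add: algebra_simps)
    finally show ?thesis by (simp add: c)
  qed
  then show "unitary_op V"
    by (simp add: unitary_op_def matrix_matrix_mult_def vec_eq_iff mat_def)
  have "trace (V ** Y) = (\<Sum>i\<in>UNIV. \<Sum>j\<in>UNIV. (if i = j then Y $ j $ i else 0)
      + c * (cnj (v $ j) * (Y $ j $ i * v $ i)))"
    unfolding trace_mult_eq V_def by (intro sum.cong refl) (auto simp: algebra_simps)
  also have "\<dots> = trace Y + (\<Sum>i\<in>UNIV. \<Sum>j\<in>UNIV. c * (cnj (v $ j) * (Y $ j $ i * v $ i)))"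
    by (simp add: sum.distrib trace_def)
  also have "(\<Sum>i\<in>UNIV. \<Sum>j\<in>UNIV. c * (cnj (v $ j) * (Y $ j $ i * v $ i)))
      = c * cinner v (Y *v v)"
    by (subst sum.swap) (simp add: cinner_def matrix_vector_mult_def sum_distrib_left)
  finally show "trace (V ** Y) = trace Y + c * cinner v (Y *v v)" .
qed

text \<open>Rotating the phase of the single direction v changes the trace by c w, where w is the
  value of the form at v. Maximality forbids a gain, which forces w to be real and
  nonnegative.\<close>

lemma positive_op_if_trace_maximal:
  fixes Y :: "'n::finite oper"
  assumes max: "\<And>V. unitary_op V \<Longrightarrow> Re (trace (V ** Y)) \<le> Re (trace Y)"
  shows "positive_op Y"
  unfolding positive_op_def
proof
  fix v :: "complex ^ 'n"
  define w where "w = cinner v (Y *v v)"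
  show "cinner v (Y *v v) \<in> \<real>\<^sub>\<ge>\<^sub>0"
  proof (cases "v = 0 \<or> w = 0")
    case True
    then show ?thesis by (auto simp: w_def)
  next
    case False
    define n where "n = (\<Sum>i\<in>UNIV. (cmod (v $ i))\<^sup>2)"
    have vn: "cinner v v = of_real n" by (simp add: n_def cinner_self)
    have "n \<noteq> 0" using False vn cinner_self_eq_0_iff[of v] by auto
    moreover have "n \<ge> 0" by (simp add: n_def sum_nonneg)
    ultimately have n: "n > 0" by simp
    \<comment> \<open>z is the phase with z w = |w|, and c below is chosen so that V multiplies v by
      z. The gain c w is then (|w| - w) / |v|^2.\<close>
    define z where "z = cnj w / of_real (cmod w)"
    have ww: "cnj w * w = of_real (cmod w) * of_real (cmod w)"
      using complex_norm_square[of w] by (simp add: power2_eq_square mult.commute)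
    have zz: "cnj z * z = 1"
      using False ww by (simp add: z_def mult.commute)
    have zw: "z * w = of_real (cmod w)"
      using False ww by (simp add: z_def)
    define c where "c = (z - 1) / of_real n"
    have "c + cnj c + cnj c * c * cinner v v = (cnj z * z - 1) / of_real n"
      using n by (simp add: c_def vn field_simps)
    then have "c + cnj c + cnj c * c * cinner v v = 0" by (simp add: zz)
    note refl = reflection_unitary[OF this]
    have "Re (trace Y + c * cinner v (Y *v v)) \<le> Re (trace Y)"
      using max[OF refl(1)] unfolding refl(2) .
    then have "Re (c * w) \<le> 0" by (simp add: w_def)
    moreover have "c * w = (of_real (cmod w) - w) / of_real n"
      by (simp add: c_def zw[symmetric] algebra_simps)
    ultimately have "cmod w \<le> Re w" using n by (simp add: divide_le_0_iff)
    then have re: "Re w = cmod w" using complex_Re_le_cmod[of w] by linarith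
    then have "Im w = 0" using cmod_power2[of w] by simp
    then show ?thesis using re by (simp add: complex_nonneg_Reals_iff flip: w_def)
  qed
qed

section \<open>The trace norm and the induced norm of superoperators\<close>

lemma continuous_on_Re_trace_mult: "continuous_on S (\<lambda>V. Re (trace (V ** X)))" for X :: "'n::finite oper"
  unfolding trace_mult_eq by (intro continuous_intros)

text \<open>Compactness supplies the maximiser V. Since unitaries form a group, W V competes with V
  for every unitary W, so V X itself satisfies the maximality criterion for positivity. Its square
  is \<open>dagger X ** X\<close> because V is unitary.\<close>

lemma ex_unitary_polar:
  fixes X :: "'n::finite oper"
  obtains V where "unitary_op V" "positive_op (V ** X)" "abs_op X = V ** X"
    "\<And>W. unitary_op W \<Longrightarrow> Re (trace (W ** X)) \<le> Re (trace (V ** X))"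
proof -
  have "\<exists>V\<in>{U. unitary_op U}. \<forall>W\<in>{U. unitary_op U}. Re (trace (W ** X)) \<le> Re (trace (V ** X))"
    by (rule continuous_attains_sup[OF compact_unitary _ continuous_on_Re_trace_mult])
       (use unitary_op_one in blast)
  then obtain V where V: "unitary_op V"
    and max: "\<And>W. unitary_op W \<Longrightarrow> Re (trace (W ** X)) \<le> Re (trace (V ** X))"
    by blast
  have pos: "positive_op (V ** X)"
  proof (rule positive_op_if_trace_maximal)
    fix W :: "'n oper" assume "unitary_op W"
    then show "Re (trace (W ** (V ** X))) \<le> Re (trace (V ** X))"
      using max[of "W ** V"] V by (simp add: unitary_op_mult matrix_mul_assoc)
  qed
  have "(V ** X) ** (V ** X) = dagger (V ** X) ** (V ** X)"
    by (simp add: positive_op_hermitian[OF pos])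
  also have "\<dots> = dagger X ** (dagger V ** V) ** X" by (simp add: dagger_mult matrix_mul_assoc)
  also have "\<dots> = dagger X ** X" using V by (simp add: unitary_op_def)
  finally have sq: "(V ** X) ** (V ** X) = dagger X ** X" .
  have "abs_op X = V ** X"
    unfolding abs_op_def using pos sq by (intro the_equality) (auto intro: positive_sqrt_unique)
  then show thesis using that V pos max by blast
qed

lemma trace_norm_attained:
  obtains V where "unitary_op V" "trace_norm X = Re (trace (V ** X))"
  using ex_unitary_polar[of X] unfolding trace_norm_def by metis

lemma Re_trace_unitary_le: "unitary_op V \<Longrightarrow> Re (trace (V ** X)) \<le> trace_norm X"
  using ex_unitary_polar[of X] unfolding trace_norm_def by metis

text \<open>Variational form of the trace norm: an upper bound needs to be checked only on the
  real-linear functionals Re (tr (V X)). Subadditivity and homogeneity are read off from it.\<close>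

lemma trace_norm_le_iff: "trace_norm X \<le> c \<longleftrightarrow> (\<forall>V. unitary_op V \<longrightarrow> Re (trace (V ** X)) \<le> c)"
  by (metis Re_trace_unitary_le order_trans trace_norm_attained)

lemma trace_norm_nonneg: "0 \<le> trace_norm X"
  using ex_unitary_polar[of X] unfolding trace_norm_def by (metis Re_trace_nonneg)

lemma trace_norm_triangle: "trace_norm (X + Y) \<le> trace_norm X + trace_norm Y"
  unfolding trace_norm_le_iff matrix_add_ldistrib trace_add
  by (auto intro!: add_mono Re_trace_unitary_le)

lemma unitary_op_uminus: "unitary_op U \<Longrightarrow> unitary_op (- U)"
proof -
  have "dagger (- U) ** (- U) = dagger U ** U"
    by (simp add: vec_eq_iff matrix_matrix_mult_def)
  then show "unitary_op U \<Longrightarrow> unitary_op (- U)" by (simp add: unitary_op_def)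
qed

lemma trace_norm_uminus: "trace_norm (- X) = trace_norm X" for X :: "'n::finite oper"
proof -
  have "trace_norm (- Y) \<le> trace_norm Y" for Y :: "'n oper"
    unfolding trace_norm_le_iff
  proof (intro allI impI)
    fix V :: "'n oper" assume "unitary_op V"
    moreover have "trace (V ** - Y) = trace (- V ** Y)" by (simp add: trace_mult_eq)
    ultimately show "Re (trace (V ** - Y)) \<le> trace_norm Y"
      by (simp only:) (intro Re_trace_unitary_le unitary_op_uminus)
  qed
  from this[of X] this[of "- X"] show ?thesis by simp
qed

lemma trace_norm_scaleR: "0 \<le> r \<Longrightarrow> trace_norm (r *\<^sub>R X) = r * trace_norm X"
proof -
  have le: "trace_norm (r *\<^sub>R X) \<le> r * trace_norm X" if "0 \<le> r" for r and X :: "'a oper"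
    unfolding trace_norm_le_iff
  proof (intro allI impI)
    fix V :: "'a oper" assume "unitary_op V"
    moreover have "trace (V ** (r *\<^sub>R X)) = r *\<^sub>R trace (V ** X)"
      by (simp add: trace_mult_eq scaleR_sum_right)
    ultimately show "Re (trace (V ** (r *\<^sub>R X))) \<le> r * trace_norm X"
      using that by (simp add: mult_left_mono Re_trace_unitary_le)
  qed
  assume r: "0 \<le> r"
  show ?thesis
  proof (cases "r = 0")
    case True
    then show ?thesis using le[of 0 X] trace_norm_nonneg[of "0 *\<^sub>R X"] by simp
  next
    case False
    then have "r * trace_norm X \<le> r * (inverse r * trace_norm (r *\<^sub>R X))"
      using r le[of "inverse r" "r *\<^sub>R X"] by (intro mult_left_mono) auto
    then have "r * trace_norm X \<le> trace_norm (r *\<^sub>R X)" using False by (simp add: mult.assoc[symmetric])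
    then show ?thesis using le[OF r, of X] by simp
  qed
qed

lemma dagger_one: "dagger (mat 1) = mat 1"
  by (simp add: vec_eq_iff mat_def)

lemma trace_norm_eq_0_imp:
  assumes "trace_norm X = 0" shows "X = 0"
proof -
  obtain V where V: "unitary_op V" "positive_op (V ** X)" "abs_op X = V ** X"
    using ex_unitary_polar[of X] by metis
  have "Re (trace (dagger (mat 1) ** (V ** X) ** mat 1)) = 0"
    using assms V by (simp add: trace_norm_def dagger_one)
  then have "V ** X = 0" using trace_conjugate_eq_0[OF V(2), of "mat 1"] by simp
  then have "(dagger V ** V) ** X = 0" by (simp add: matrix_mul_assoc[symmetric])
  then show ?thesis using V by (simp add: unitary_op_def)
qed

lemma trace_norm_le_norm:
  fixes X :: "'n::finite oper"
  shows "trace_norm X \<le> (real CARD('n))\<^sup>2 * norm X"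
  unfolding trace_norm_le_iff
proof (intro allI impI)
  fix V :: "'n oper" assume V: "unitary_op V"
  have "Re (trace (V ** X)) \<le> cmod (trace (V ** X))" by (rule complex_Re_le_cmod)
  also have "\<dots> \<le> (\<Sum>i\<in>(UNIV::'n set). \<Sum>j\<in>(UNIV::'n set). norm X)"
    unfolding trace_mult_eq
  proof (intro order_trans[OF norm_sum] sum_mono order_trans[OF norm_sum])
    fix i j
    have "cmod (V $ i $ j * X $ j $ i) \<le> 1 * norm X"
      unfolding norm_mult by (intro mult_mono unitary_op_entry_le V norm_oper_entry_le) auto
    then show "cmod (V $ i $ j * X $ j $ i) \<le> norm X" by simp
  qed
  also have "\<dots> = (real CARD('n))\<^sup>2 * norm X" by (simp add: power2_eq_square)
  finally show "Re (trace (V ** X)) \<le> (real CARD('n))\<^sup>2 * norm X" .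
qed

lemma trace_norm_diff_le: "\<bar>trace_norm X - trace_norm Y\<bar> \<le> trace_norm (X - Y)"
  using trace_norm_triangle[of "X - Y" Y] trace_norm_triangle[of "Y - X" X]
    trace_norm_uminus[of "X - Y"] by simp

lemma continuous_on_trace_norm: "continuous_on S (trace_norm :: 'n::finite oper \<Rightarrow> real)"
proof -
  have "((real CARD('n))\<^sup>2)-lipschitz_on S (trace_norm :: 'n oper \<Rightarrow> real)"
    by (rule lipschitz_onI)
       (auto simp: dist_norm intro: order_trans[OF trace_norm_diff_le trace_norm_le_norm])
  then show ?thesis by (rule lipschitz_on_continuous_on)
qed

text \<open>The continuous trace norm attains a positive minimum on the compact unit sphere. This
  equivalence of norms is what makes the supremum in \<open>norm_1to1\<close> one of a bounded
  set.\<close>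

lemma norm_le_trace_norm: "\<exists>c>0. \<forall>X :: 'n::finite oper. norm X \<le> c * trace_norm X"
proof -
  let ?S = "sphere (0 :: 'n oper) 1"
  have "?S \<noteq> {}" by simp
  then obtain X0 where X0: "X0 \<in> ?S" "\<And>X. X \<in> ?S \<Longrightarrow> trace_norm X0 \<le> trace_norm X"
    using continuous_attains_inf[OF compact_sphere _ continuous_on_trace_norm, of 0 1] by blast
  have pos: "0 < trace_norm X0"
    using X0(1) trace_norm_nonneg[of X0] trace_norm_eq_0_imp[of X0] by (force simp: less_le)
  show ?thesis
  proof (intro exI conjI allI)
    show "0 < inverse (trace_norm X0)" using pos by simp
    fix X :: "'n oper"
    show "norm X \<le> inverse (trace_norm X0) * trace_norm X"
    proof (cases "X = 0")
      case True
      then show ?thesis using pos trace_norm_nonneg[of X] by simp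
    next
      case False
      then have "trace_norm X0 \<le> trace_norm (inverse (norm X) *\<^sub>R X)"
        by (intro X0(2)) simp
      then show ?thesis using pos False by (simp add: trace_norm_scaleR field_simps)
    qed
  qed
qed

lemma trace_norm_1_ex: "\<exists>A :: 'n::finite oper. trace_norm A = 1"
proof -
  obtain c where "0 < c" and c: "\<And>X :: 'n oper. norm X \<le> c * trace_norm X"
    using norm_le_trace_norm by blast
  define X :: "'n oper" where "X = mat 1"
  have "X \<noteq> 0" by (simp add: X_def mat_def vec_eq_iff)
  then have "trace_norm X \<noteq> 0" using trace_norm_eq_0_imp by blast
  then have "trace_norm (inverse (trace_norm X) *\<^sub>R X) = 1"
    using trace_norm_nonneg[of X] by (simp add: trace_norm_scaleR)
  then show ?thesis by blast
qed

lemma ex_trace_norm_blinfun_bound: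
  "\<exists>c>0. \<forall>(T :: 'n::finite superop) A. trace_norm (blinfun_apply T A) \<le> c * norm T * trace_norm A"
proof -
  obtain c where c: "0 < c" "\<And>X :: 'n oper. norm X \<le> c * trace_norm X"
    using norm_le_trace_norm by blast
  let ?N = "(real CARD('n))\<^sup>2"
  show ?thesis
  proof (intro exI conjI allI)
    show "0 < ?N * c" using c by simp
    fix T :: "'n superop" and A
    have "trace_norm (blinfun_apply T A) \<le> ?N * norm (T A)" by (rule trace_norm_le_norm)
    also have "\<dots> \<le> ?N * (norm T * norm A)" by (intro mult_left_mono norm_blinfun) auto
    also have "\<dots> \<le> ?N * (norm T * (c * trace_norm A))" by (intro mult_left_mono c) auto
    finally show "trace_norm (blinfun_apply T A) \<le> ?N * c * norm T * trace_norm A" by (simp add: mult_ac)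
  qed
qed

section \<open>The induced norm as a submultiplicative norm\<close>

lemma norm_1to1_leI:
  fixes T :: "'n::finite superop"
  assumes "\<And>A. trace_norm (blinfun_apply T A) \<le> c * trace_norm A"
  shows "norm_1to1 T \<le> c"
  unfolding norm_1to1_def
proof (rule cSUP_least)
  show "{A. trace_norm A = 1} \<noteq> {}" using trace_norm_1_ex by auto
  fix A :: "'n oper" assume "A \<in> {A. trace_norm A = 1}"
  then show "trace_norm (blinfun_apply T A) \<le> c" using assms[of A] by simp
qed

lemma trace_norm_apply_le: "trace_norm (blinfun_apply T A) \<le> norm_1to1 T * trace_norm A"
  for T :: "'n::finite superop"
proof (cases "trace_norm A = 0")
  case True
  then show ?thesis using trace_norm_eq_0_imp[of A] by auto
next
  case False
  then have r: "trace_norm A > 0" using trace_norm_nonneg[of A] by simp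
  obtain c where "0 < c" and c: "\<And>(T :: 'n superop) A. trace_norm (blinfun_apply T A) \<le> c * norm T * trace_norm A"
    using ex_trace_norm_blinfun_bound by blast
  have "trace_norm (T (inverse (trace_norm A) *\<^sub>R A)) \<le> norm_1to1 T"
    unfolding norm_1to1_def
  proof (rule cSUP_upper)
    show "inverse (trace_norm A) *\<^sub>R A \<in> {A. trace_norm A = 1}" using r by (simp add: trace_norm_scaleR)
    show "bdd_above ((\<lambda>A. trace_norm (blinfun_apply T A)) ` {A. trace_norm A = 1})"
    proof (rule bdd_aboveI2)
      fix A :: "'n oper" assume "A \<in> {A. trace_norm A = 1}"
      then show "trace_norm (blinfun_apply T A) \<le> c * norm T" using c[of T A] by simp
    qed
  qed
  then show ?thesis using r by (simp add: blinfun.scaleR_right trace_norm_scaleR field_simps)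
qed

lemma norm_1to1_nonneg: "0 \<le> norm_1to1 T"
  by (metis mult.right_neutral order_trans trace_norm_1_ex trace_norm_apply_le trace_norm_nonneg)

lemma norm_1to1_triangle: "norm_1to1 (S + T) \<le> norm_1to1 S + norm_1to1 T"
proof (rule norm_1to1_leI)
  fix A
  have "trace_norm (blinfun_apply (S + T) A) \<le> trace_norm (blinfun_apply S A) + trace_norm (blinfun_apply T A)"
    by (simp add: blinfun.add_left trace_norm_triangle)
  also have "\<dots> \<le> norm_1to1 S * trace_norm A + norm_1to1 T * trace_norm A"
    by (intro add_mono trace_norm_apply_le)
  finally show "trace_norm (blinfun_apply (S + T) A) \<le> (norm_1to1 S + norm_1to1 T) * trace_norm A"
    by (simp add: distrib_right)
qed

lemma norm_1to1_uminus: "norm_1to1 (- T) = norm_1to1 T"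
  by (simp add: norm_1to1_def blinfun.minus_left trace_norm_uminus)

lemma norm_1to1_triangle_diff: "norm_1to1 (S - T) \<le> norm_1to1 S + norm_1to1 T"
  using norm_1to1_triangle[of S "- T"] by (simp add: norm_1to1_uminus)

lemma norm_1to1_zero [simp]: "norm_1to1 (0 :: 'n::finite superop) = 0"
  by (rule antisym[OF norm_1to1_leI norm_1to1_nonneg])
     (use trace_norm_scaleR[of 0 "0 :: 'n oper"] in simp)

lemma norm_1to1_sum: "norm_1to1 (\<Sum>i\<in>I. f i) \<le> (\<Sum>i\<in>I. norm_1to1 (f i))"
  by (induction I rule: infinite_finite_induct) (auto intro: order_trans[OF norm_1to1_triangle])

lemma norm_1to1_compose: "norm_1to1 (S o\<^sub>L T) \<le> norm_1to1 S * norm_1to1 T"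
proof (rule norm_1to1_leI)
  fix A
  have "trace_norm (blinfun_apply S (blinfun_apply T A)) \<le> norm_1to1 S * trace_norm (blinfun_apply T A)" by (rule trace_norm_apply_le)
  also have "\<dots> \<le> norm_1to1 S * (norm_1to1 T * trace_norm A)"
    by (intro mult_left_mono trace_norm_apply_le norm_1to1_nonneg)
  finally show "trace_norm (blinfun_apply (S o\<^sub>L T) A) \<le> norm_1to1 S * norm_1to1 T * trace_norm A"
    by (simp add: mult.assoc)
qed

lemma norm_1to1_id: "norm_1to1 id_blinfun \<le> 1"
  by (rule norm_1to1_leI) simp

lemma norm_1to1_le_norm: "\<exists>c>0. \<forall>T :: 'n::finite superop. norm_1to1 T \<le> c * norm T"
  using ex_trace_norm_blinfun_bound[where 'n = 'n] by (meson norm_1to1_leI)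

text \<open>Duality moves the norm inside the integral: for fixed A, a unitary V attaining the trace
  norm of I A gives a bounded linear functional, which commutes with the integral and is dominated
  pointwise.\<close>

lemma norm_1to1_has_integral_le:
  fixes f :: "real \<Rightarrow> 'n::finite superop"
  assumes f: "(f has_integral I) S" and g: "(g has_integral J) S"
    and le: "\<And>x. x \<in> S \<Longrightarrow> norm_1to1 (f x) \<le> g x"
  shows "norm_1to1 I \<le> J"
proof (rule norm_1to1_leI)
  fix A :: "'n oper"
  obtain V where V: "unitary_op V" "trace_norm (I A) = Re (trace (V ** I A))"
    by (rule trace_norm_attained)
  have "linear (\<lambda>Y. Re (trace (V ** Y)))"
    by (rule linearI)
       (simp_all add: trace_mult_eq distrib_left sum.distrib scaleR_sum_right[symmetric])
  then have "bounded_linear (\<lambda>Y. Re (trace (V ** Y)))" by (simp add: linear_conv_bounded_linear)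
  then have lin: "bounded_linear (\<lambda>T. Re (trace (V ** blinfun_apply T A)))"
    by (rule bounded_linear_compose[OF _ blinfun.bounded_linear_left])
  have "((\<lambda>x. Re (trace (V ** f x A))) has_integral Re (trace (V ** I A))) S"
    using has_integral_linear[OF f lin] by (simp add: o_def)
  moreover have "((\<lambda>x. g x * trace_norm A) has_integral J * trace_norm A) S"
    by (rule has_integral_mult_left[OF g])
  moreover have "Re (trace (V ** f x A)) \<le> g x * trace_norm A" if "x \<in> S" for x
    using Re_trace_unitary_le[OF V(1)] trace_norm_apply_le le[OF that] trace_norm_nonneg[of A]
    by (meson mult_right_mono order_trans)
  ultimately have "Re (trace (V ** I A)) \<le> J * trace_norm A" by (rule has_integral_le)
  then show "trace_norm (I A) \<le> J * trace_norm A" by (simp add: V)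
qed

section \<open>Channels are contractions for the trace norm\<close>

lemma positive_block_op_2:
  "positive_block_op 2 X \<longleftrightarrow> (\<forall>v w.
     cinner v (X 0 0 *v v) + cinner v (X 0 1 *v w) + cinner w (X 1 0 *v v) + cinner w (X 1 1 *v w) \<in> \<real>\<^sub>\<ge>\<^sub>0)"
    (is "_ \<longleftrightarrow> (\<forall>v w. ?f v w \<in> _)")
proof -
  have "(\<Sum>p<2. \<Sum>q<2. cinner (v p) (X p q *v v q)) = ?f (v 0) (v 1)" for v :: "nat \<Rightarrow> _"
    by (simp add: numeral_2_eq_2)
  then have "positive_block_op 2 X \<longleftrightarrow> (\<forall>v :: nat \<Rightarrow> _. ?f (v 0) (v 1) \<in> \<real>\<^sub>\<ge>\<^sub>0)"
    by (simp add: positive_block_op_def)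
  also have "\<dots> \<longleftrightarrow> (\<forall>v w. ?f v w \<in> \<real>\<^sub>\<ge>\<^sub>0)"
  proof (intro iffI allI)
    fix v w assume "\<forall>v :: nat \<Rightarrow> _. ?f (v 0) (v 1) \<in> \<real>\<^sub>\<ge>\<^sub>0"
    from this[rule_format, of "\<lambda>i. if i = 0 then v else w"] show "?f v w \<in> \<real>\<^sub>\<ge>\<^sub>0" by simp
  qed blast
  finally show ?thesis .
qed

text \<open>
  For \<open>X = U |X|\<close> with \<open>U\<close> unitary, the block operator with rows \<open>U |X| U\<^sup>*, X\<close> and \<open>X\<^sup>*, |X|\<close> is
  positive. So is its blockwise image under \<open>T\<close>, whose form at \<open>(V\<^sup>* e\<^sub>k, - e\<^sub>k)\<close>, summed over \<open>k\<close>,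
  bounds \<open>Re (tr (V T(X)))\<close>.
\<close>

lemma trace_norm_quantum_channel_le:
  fixes T :: "'n::finite superop"
  assumes cp: "completely_positive T" and tp: "trace_preserving T"
  shows "trace_norm (T X) \<le> trace_norm X"
proof -
  obtain W where W: "unitary_op W" "positive_op (W ** X)" "abs_op X = W ** X"
    using ex_unitary_polar[of X] by metis
  define P where "P = W ** X"
  define U where "U = dagger W"
  have P: "positive_op P" and hP: "dagger P = P" using W by (simp_all add: P_def positive_op_hermitian)
  have UX: "U ** P = X" using W by (simp add: U_def P_def matrix_mul_assoc unitary_op_def)
  define B :: "nat \<Rightarrow> nat \<Rightarrow> 'n oper"
    where "B p q = (if p = 0 then if q = 0 then U ** P ** dagger U else X
                    else if q = 0 then dagger X else P)" for p q
  have "positive_block_op 2 B"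
    unfolding positive_block_op_2
  proof (intro allI)
    fix v w
    let ?u = "dagger U *v v"
    have "cinner v (B 0 0 *v v) + cinner v (B 0 1 *v w) + cinner w (B 1 0 *v v) + cinner w (B 1 1 *v w)
      = cinner ?u (P *v ?u) + cinner ?u (P *v w) + cinner w (P *v ?u) + cinner w (P *v w)"
      by (simp add: B_def UX[symmetric] dagger_mult hP matrix_vector_mul_assoc[symmetric]
          cinner_matrix_right[of v U])
    also have "\<dots> = cinner (?u + w) (P *v (?u + w))"
      by (simp add: cinner_add_left cinner_add_right matrix_vector_right_distrib)
    also have "\<dots> \<in> \<real>\<^sub>\<ge>\<^sub>0" using P by (auto simp: positive_op_def)
    finally show "cinner v (B 0 0 *v v) + cinner v (B 0 1 *v w) + cinner w (B 1 0 *v v)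
      + cinner w (B 1 1 *v w) \<in> \<real>\<^sub>\<ge>\<^sub>0" .
  qed
  then have "positive_block_op 2 (\<lambda>p q. T (B p q))"
    using cp by (auto simp: completely_positive_def)
  then have pos: "cinner v (T (U ** P ** dagger U) *v v) + cinner v (T X *v w)
      + cinner w (T (dagger X) *v v) + cinner w (T P *v w) \<in> \<real>\<^sub>\<ge>\<^sub>0" for v w
    unfolding positive_block_op_2 by (simp add: B_def)
  \<comment> \<open>The image of the block operator has a real form, so polarization at w and \<i> w
    shows its off-diagonal blocks to be adjoint to each other. That T commutes with
    \<open>dagger\<close> at X is obtained here and not assumed.\<close>
  have herm: "cinner w (T (dagger X) *v v) = cnj (cinner v (T X *v w))" for v w
  proof (rule eq_cnjI)
    have a: "Im (cinner v (T (U ** P ** dagger U) *v v)) = 0"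
      using pos[of v 0] by (simp add: complex_nonneg_Reals_iff)
    have b: "Im (cinner w (T P *v w)) = 0" for w
      using pos[of 0 w] by (simp add: complex_nonneg_Reals_iff)
    show "Im (cinner v (T X *v w) + cinner w (T (dagger X) *v v)) = 0"
      using pos[of v w] a b by (simp add: complex_nonneg_Reals_iff)
    show "Im (\<i> * cinner v (T X *v w) - \<i> * cinner w (T (dagger X) *v v)) = 0"
      using pos[of v "\<i> *s w"] a b[of "\<i> *s w"]
      by (simp add: complex_nonneg_Reals_iff vector_scalar_commute cinner_scale_left cinner_scale_right)
  qed
  have main: "2 * Re (cinner v (T X *v w)) \<le>
      Re (cinner v (T (U ** P ** dagger U) *v v)) + Re (cinner w (T P *v w))" for v w
  proof -
    show ?thesis
      using pos[of v "- w"] herm[of w v]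
      by (simp add: complex_nonneg_Reals_iff cinner_minus_left cinner_minus_right matrix_vector_mult_minus_right)
  qed
  show ?thesis
    unfolding trace_norm_le_iff
  proof (intro allI impI)
    fix V :: "'n oper" assume V: "unitary_op V"
    have "trace (V ** T X) = (\<Sum>k\<in>UNIV. cinner (dagger V *v axis k 1) (T X *v axis k 1))"
      unfolding trace_eq_sum_cinner by (simp only: matrix_vector_mul_assoc[symmetric] cinner_matrix_right[of _ V])
    then have "2 * Re (trace (V ** T X)) = (\<Sum>k\<in>UNIV. 2 * Re (cinner (dagger V *v axis k 1) (T X *v axis k 1)))"
      by (simp add: sum_distrib_left)
    also have "\<dots> \<le> (\<Sum>k\<in>UNIV. Re (cinner (dagger V *v axis k 1)
          (T (U ** P ** dagger U) *v (dagger V *v axis k 1))) + Re (cinner (axis k 1) (T P *v axis k 1)))"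
      by (intro sum_mono main)
    also have "\<dots> = Re (trace (V ** T (U ** P ** dagger U) ** dagger V)) + Re (trace (T P))"
      using cinner_conjugate[of _ "dagger V"] unfolding trace_eq_sum_cinner by (simp add: sum.distrib)
    also have "trace (V ** T (U ** P ** dagger U) ** dagger V) = trace (T (U ** P ** dagger U))"
      using V trace_mul_sym[of "V ** T (U ** P ** dagger U)" "dagger V"]
      by (simp add: matrix_mul_assoc unitary_op_def)
    \<comment> \<open>Trace preservation turns both diagonal contributions into tr P, the trace norm
      of X as P = |X|; the factor 2 then cancels.\<close>
    also have "\<dots> = trace P"
      using tp W trace_mul_sym[of "U ** P" "dagger U"]
      by (simp add: trace_preserving_def matrix_mul_assoc U_def unitary_op_right)
    also have "trace (T P) = trace P" using tp by (simp add: trace_preserving_def)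
    finally show "Re (trace (V ** T X)) \<le> trace_norm X"
      using W by (simp add: trace_norm_def P_def)
  qed
qed

lemma norm_1to1_quantum_channel: "quantum_channel T \<Longrightarrow> norm_1to1 T \<le> 1"
  by (rule norm_1to1_leI) (simp add: quantum_channel_def trace_norm_quantum_channel_le)

lemma quantum_channel_compose:
  "quantum_channel S \<Longrightarrow> quantum_channel T \<Longrightarrow> quantum_channel (S o\<^sub>L T)"
  unfolding quantum_channel_def complex_linear_def completely_positive_def trace_preserving_def
  by simp

lemma quantum_channel_id: "quantum_channel id_blinfun"
  unfolding quantum_channel_def complex_linear_def completely_positive_def trace_preserving_def
  by simp

section \<open>Evolution equations with regulated generators\<close>

text \<open>Regulated functions of classical analysis. The values at the points themselves are
  unrestricted, so jumps are harmless; the property passes to subintervals and products and yields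
  boundedness and integrability.\<close>

definition regulated_on :: "real \<Rightarrow> real \<Rightarrow> (real \<Rightarrow> 'a::topological_space) \<Rightarrow> bool" where
  "regulated_on a b f \<longleftrightarrow>
     (\<forall>x\<in>{a..<b}. \<exists>l. (f \<longlongrightarrow> l) (at_right x)) \<and> (\<forall>x\<in>{a<..b}. \<exists>l. (f \<longlongrightarrow> l) (at_left x))"

lemma piecewise_continuous_regulated:
  "piecewise_continuous f \<Longrightarrow> 0 \<le> a \<Longrightarrow> regulated_on a b f"
  by (auto simp: piecewise_continuous_def regulated_on_def)

lemma regulated_on_subset:
  "regulated_on a b f \<Longrightarrow> a \<le> c \<Longrightarrow> d \<le> b \<Longrightarrow> regulated_on c d f"
  by (auto simp: regulated_on_def)

lemma regulated_on_localE:
  fixes f :: "real \<Rightarrow> 'a::metric_space"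
  assumes f: "regulated_on a b f" and x: "a \<le> x" "x \<le> b" and e: "0 < e"
  obtains d l l' where "0 < d"
    "\<And>y. y \<in> {a..b} \<Longrightarrow> x < y \<Longrightarrow> y < x + d \<Longrightarrow> dist (f y) l < e"
    "\<And>y. y \<in> {a..b} \<Longrightarrow> x - d < y \<Longrightarrow> y < x \<Longrightarrow> dist (f y) l' < e"
proof -
  have "\<exists>d l. 0 < d \<and> (\<forall>y\<in>{a..b}. x < y \<longrightarrow> y < x + d \<longrightarrow> dist (f y) l < e)"
  proof (cases "x < b")
    case True
    then obtain l where "(f \<longlongrightarrow> l) (at_right x)" using f x by (force simp: regulated_on_def)
    then have "\<forall>\<^sub>F y in at_right x. dist (f y) l < e" using e by (rule tendstoD)
    then obtain z where "z > x" "\<forall>y>x. y < z \<longrightarrow> dist (f y) l < e"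
      unfolding eventually_at_right_field by blast
    then show ?thesis by (intro exI[of _ "z - x"] exI[of _ l]) auto
  next
    case False
    then show ?thesis by (intro exI[of _ 1]) auto
  qed
  moreover have "\<exists>d l. 0 < d \<and> (\<forall>y\<in>{a..b}. x - d < y \<longrightarrow> y < x \<longrightarrow> dist (f y) l < e)"
  proof (cases "a < x")
    case True
    then obtain l where "(f \<longlongrightarrow> l) (at_left x)" using f x by (force simp: regulated_on_def)
    then have "\<forall>\<^sub>F y in at_left x. dist (f y) l < e" using e by (rule tendstoD)
    then obtain z where "z < x" "\<forall>y>z. y < x \<longrightarrow> dist (f y) l < e"
      unfolding eventually_at_left_field by blast
    then show ?thesis by (intro exI[of _ "x - z"] exI[of _ l]) auto
  next
    case False
    then show ?thesis by (intro exI[of _ 1]) auto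
  qed
  ultimately obtain d1 l d2 l' where "0 < d1" "0 < d2"
    "\<forall>y\<in>{a..b}. x < y \<longrightarrow> y < x + d1 \<longrightarrow> dist (f y) l < e"
    "\<forall>y\<in>{a..b}. x - d2 < y \<longrightarrow> y < x \<longrightarrow> dist (f y) l' < e"
    by blast
  then show thesis by (intro that[of "min d1 d2" l l']) auto
qed

lemma regulated_on_bounded:
  fixes f :: "real \<Rightarrow> 'a::real_normed_vector"
  assumes f: "regulated_on a b f"
  obtains B where "0 \<le> B" "\<And>x. x \<in> {a..b} \<Longrightarrow> norm (f x) \<le> B"
proof (cases "a \<le> b")
  case True
  \<comment> \<open>The doubled interval prepares the bisection: the small intervals around an
    endpoint may leave [a, b], so the claim for [u, v] concerns only the part inside.\<close>
  have "\<exists>B. \<forall>y\<in>{a..b} \<inter> {a..b}. norm (f y) \<le> B"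
    using True
  proof (induction a b rule: Bolzano[where P = "\<lambda>u v. \<exists>B. \<forall>y\<in>{u..v} \<inter> {a..b}. norm (f y) \<le> B"])
    case (trans u v w)
    then obtain B1 B2 where "\<forall>y\<in>{u..v} \<inter> {a..b}. norm (f y) \<le> B1" "\<forall>y\<in>{v..w} \<inter> {a..b}. norm (f y) \<le> B2"
      by blast
    then show ?case by (intro exI[of _ "max B1 B2"]) (auto simp: le_max_iff_disj)
  next
    case (local x)
    obtain d l l' where d: "0 < d"
      "\<And>y. y \<in> {a..b} \<Longrightarrow> x < y \<Longrightarrow> y < x + d \<Longrightarrow> dist (f y) l < 1"
      "\<And>y. y \<in> {a..b} \<Longrightarrow> x - d < y \<Longrightarrow> y < x \<Longrightarrow> dist (f y) l' < 1"
      using regulated_on_localE[OF f local, of 1] by auto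
    have "norm (f y) \<le> norm (f x) + norm l + norm l' + 1" if "y \<in> {a..b}" "x - d < y" "y < x + d" for y
    proof -
      have r: "norm (f y) \<le> norm l + dist (f y) l" "norm (f y) \<le> norm l' + dist (f y) l'"
        by (metis add.commute dist_norm norm_triangle_sub)+
      consider "y < x" | "y = x" | "x < y" by linarith
      then show ?thesis
      proof cases
        case 1
        then show ?thesis using d(3)[of y] that r(2) norm_ge_zero[of "f x"] norm_ge_zero[of l] by linarith
      next
        case 3
        then show ?thesis using d(2)[of y] that r(1) norm_ge_zero[of "f x"] norm_ge_zero[of l'] by linarith
      qed auto
    qed
    then show ?case
      using d(1) by (intro exI[of _ d]) (auto intro!: exI[of _ "norm (f x) + norm l + norm l' + 1"])
  qed
  then obtain B where "\<forall>y\<in>{a..b}. norm (f y) \<le> B" by auto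
  then show ?thesis by (intro that[of "max B 0"]) (auto simp: le_max_iff_disj)
next
  case False
  then show ?thesis by (intro that[of 0]) auto
qed

text \<open>Bisection builds an integrable function within e of f: near x it is constant on either
  side, with the one-sided limits as values, and equals f at x. Uniform limits of integrable
  functions are integrable.\<close>

lemma regulated_on_integrable:
  fixes f :: "real \<Rightarrow> 'a::banach"
  assumes f: "regulated_on a b f"
  shows "f integrable_on {a..b}"
proof (cases "a \<le> b")
  case True
  have "\<exists>g. (\<forall>x\<in>cbox a b. norm (f x - g x) \<le> e) \<and> g integrable_on cbox a b" if e: "e > 0" for e
  proof -
    have "\<exists>g. (\<forall>y\<in>{a..b} \<inter> {a..b}. norm (f y - g y) \<le> e) \<and> g integrable_on {a..b}"
      using True
    proof (induction a b rule: Bolzano[where P = "\<lambda>u v. \<exists>g. (\<forall>y\<in>{u..v} \<inter> {a..b}. norm (f y - g y) \<le> e)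
        \<and> g integrable_on {u..v}"])
      case (trans u v w)
      then obtain g1 g2 where g:
        "\<forall>y\<in>{u..v} \<inter> {a..b}. norm (f y - g1 y) \<le> e" "g1 integrable_on {u..v}"
        "\<forall>y\<in>{v..w} \<inter> {a..b}. norm (f y - g2 y) \<le> e" "g2 integrable_on {v..w}"
        by blast
      let ?g = "\<lambda>y. if y \<le> v then g1 y else g2 y"
      have "?g integrable_on {u..v}"
        by (rule integrable_spike_finite[of "{}", OF _ _ g(2)]) auto
      moreover have "?g integrable_on {v..w}"
        by (rule integrable_spike_finite[of "{v}", OF _ _ g(4)]) auto
      ultimately have "?g integrable_on {u..w}"
        using trans by (intro Henstock_Kurzweil_Integration.integrable_combine[of u v w]) auto
      then show ?case using g by (intro exI[of _ ?g]) auto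
    next
      case (local x)
      obtain d l l' where d: "0 < d"
        "\<And>y. y \<in> {a..b} \<Longrightarrow> x < y \<Longrightarrow> y < x + d \<Longrightarrow> dist (f y) l < e"
        "\<And>y. y \<in> {a..b} \<Longrightarrow> x - d < y \<Longrightarrow> y < x \<Longrightarrow> dist (f y) l' < e"
        using regulated_on_localE[OF f local e] by auto
      let ?g = "\<lambda>y. if y < x then l' else if y = x then f x else l"
      have int: "?g integrable_on {u..v}" if "u \<le> x" "x \<le> v" for u v
      proof (rule Henstock_Kurzweil_Integration.integrable_combine[OF that])
        show "?g integrable_on {u..x}"
          by (rule integrable_spike_finite[of "{x}" _ _ "\<lambda>_. l'"]) auto
        show "?g integrable_on {x..v}"
          by (rule integrable_spike_finite[of "{x}" _ _ "\<lambda>_. l"]) auto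
      qed
      have "norm (f y - ?g y) \<le> e" if "y \<in> {a..b}" "x - d < y" "y < x + d" for y
        using d(2)[of y] d(3)[of y] that e by (auto simp: dist_norm not_less intro: less_imp_le)
      then show ?case
        using d(1) int by (intro exI[of _ d] conjI allI impI exI[of _ ?g]) auto
    qed
    then show ?thesis by simp
  qed
  then show ?thesis using integrable_uniform_limit[of a b f] by simp
next
  case False
  then show ?thesis by (simp add: integrable_on_empty)
qed

lemma continuous_on_imp_regulated_on:
  fixes f :: "real \<Rightarrow> 'a::topological_space"
  assumes "continuous_on {a..b} f"
  shows "regulated_on a b f"
  unfolding regulated_on_def
proof (intro conjI ballI)
  fix x assume x: "x \<in> {a..<b}"
  then have "continuous_on {x..b} f" using assms by (auto intro: continuous_on_subset)
  then show "\<exists>l. (f \<longlongrightarrow> l) (at_right x)" using x continuous_on_Icc_at_rightD[of x b f] by auto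
next
  fix x assume x: "x \<in> {a<..b}"
  then have "continuous_on {a..x} f" using assms by (auto intro: continuous_on_subset)
  then show "\<exists>l. (f \<longlongrightarrow> l) (at_left x)" using x continuous_on_Icc_at_leftD[of a x f] by auto
qed

lemma blinfun_compose_id_right: "T o\<^sub>L id_blinfun = T"
  by (rule blinfun_eqI) simp

lemma blinfun_compose_id_left: "id_blinfun o\<^sub>L T = T"
  by (rule blinfun_eqI) simp

lemma blinfun_compose_assoc: "(R o\<^sub>L S) o\<^sub>L T = R o\<^sub>L (S o\<^sub>L T)"
  by (rule blinfun_eqI) simp

lemma regulated_on_compose:
  fixes f :: "real \<Rightarrow> 'b::real_normed_vector \<Rightarrow>\<^sub>L 'c::real_normed_vector"
    and g :: "real \<Rightarrow> 'a::real_normed_vector \<Rightarrow>\<^sub>L 'b"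
  assumes "regulated_on a b f" "regulated_on a b g"
  shows "regulated_on a b (\<lambda>x. f x o\<^sub>L g x)"
proof -
  have "\<exists>l. ((\<lambda>x. f x o\<^sub>L g x) \<longlongrightarrow> l) F" if "\<exists>l. (f \<longlongrightarrow> l) F" "\<exists>l. (g \<longlongrightarrow> l) F" for F
    using that by (blast intro: bounded_bilinear.tendsto[OF bounded_bilinear_blinfun_compose])
  then show ?thesis using assms unfolding regulated_on_def by simp
qed

lemma regulated_on_compose_continuous:
  fixes f :: "real \<Rightarrow> 'b::real_normed_vector \<Rightarrow>\<^sub>L 'c::banach"
    and g :: "real \<Rightarrow> 'a::real_normed_vector \<Rightarrow>\<^sub>L 'b"
  assumes "regulated_on a b f" "continuous_on {a..b} g"
  shows "(\<lambda>x. f x o\<^sub>L g x) integrable_on {a..b}"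
  by (intro regulated_on_integrable regulated_on_compose assms continuous_on_imp_regulated_on)

section \<open>Gronwall's inequality\<close>

definition exp_term :: "real \<Rightarrow> real \<Rightarrow> nat \<Rightarrow> real \<Rightarrow> real" where
  "exp_term s c n x = (c * (x - s)) ^ n / fact n"

lemma exp_term_0 [simp]: "exp_term s c 0 x = 1"
  by (simp add: exp_term_def)

lemma exp_term_mono: "0 \<le> c \<Longrightarrow> s \<le> x \<Longrightarrow> x \<le> y \<Longrightarrow> exp_term s c n x \<le> exp_term s c n y"
  unfolding exp_term_def by (intro divide_right_mono power_mono mult_left_mono) auto

lemma exp_term_sums: "(\<lambda>n. exp_term s c n x) sums exp (c * (x - s))"
  using exp_converges[of "c * (x - s)"] by (simp add: exp_term_def scaleR_conv_of_real divide_inverse mult.commute)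

lemma continuous_on_exp_term: "continuous_on S (exp_term s c n)"
  unfolding exp_term_def by (intro continuous_intros) auto

lemma has_integral_exp_term:
  assumes "s \<le> r"
  shows "((\<lambda>x. c * exp_term s c n x) has_integral exp_term s c (Suc n) r) {s..r}"
proof -
  have "(exp_term s c (Suc n) has_vector_derivative c * exp_term s c n x) (at x within {s..r})" for x
  proof -
    have "((\<lambda>x. c * (x - s)) has_real_derivative c) (at x within {s..r})"
      by (auto intro!: derivative_eq_intros)
    then have "((\<lambda>x. (c * (x - s)) ^ Suc n / fact (Suc n)) has_real_derivative
        (1 + real n) * (c * (c * (x - s)) ^ n) / fact (Suc n)) (at x within {s..r})"
      by (intro DERIV_cdivide DERIV_power_Suc)
    moreover have "(1 + real n) * (c * (c * (x - s)) ^ n) / fact (Suc n) = c * exp_term s c n x"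
      by (simp add: exp_term_def divide_simps)
    ultimately show ?thesis
      unfolding exp_term_def[abs_def] has_real_derivative_iff_has_vector_derivative by simp
  qed
  from fundamental_theorem_of_calculus[OF assms this] show ?thesis
    by (simp add: exp_term_def[of s c "Suc n" s])
qed

lemma has_integral_exp:
  fixes c :: real assumes "s \<le> r"
  shows "((\<lambda>x. c * exp (c * (x - s))) has_integral exp (c * (r - s)) - 1) {s..r}"
proof -
  have "((\<lambda>x. exp (c * (x - s))) has_vector_derivative c * exp (c * (x - s))) (at x within {s..r})" for x
    unfolding has_real_derivative_iff_has_vector_derivative[symmetric]
    by (auto intro!: derivative_eq_intros)
  from fundamental_theorem_of_calculus[OF assms this] show ?thesis by simp
qed

text \<open>The integral inequality is demanded for continuous majorants g instead of f, so that f,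
  in the application a \<open>norm_1to1\<close> along a solution, need not be shown integrable.
  Iteration from the constant C gives partial sums of the exponential series plus C times a single
  term, which tends to 0.\<close>

lemma gronwall:
  fixes f :: "real \<Rightarrow> real"
  assumes c: "0 \<le> c" and bounded: "\<And>x. x \<in> {s..b} \<Longrightarrow> f x \<le> C"
    and step: "\<And>g r. continuous_on {s..b} g \<Longrightarrow> (\<And>x. x \<in> {s..b} \<Longrightarrow> f x \<le> g x) \<Longrightarrow> r \<in> {s..b} \<Longrightarrow>
        f r \<le> a + integral {s..r} (\<lambda>x. c * g x)"
    and r: "r \<in> {s..b}"
  shows "f r \<le> a * exp (c * (r - s))"
proof -
  have *: "f x \<le> a * (\<Sum>k<n. exp_term s c k x) + C * exp_term s c n x" if "x \<in> {s..b}" for n x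
    using that
  proof (induction n arbitrary: x)
    case 0
    then show ?case using bounded by simp
  next
    case (Suc n)
    let ?g = "\<lambda>x. a * (\<Sum>k<n. exp_term s c k x) + C * exp_term s c n x"
    have sx: "s \<le> x" using Suc by simp
    have "((\<lambda>y. a * (\<Sum>k<n. c * exp_term s c k y) + C * (c * exp_term s c n y)) has_integral
        a * (\<Sum>k<n. exp_term s c (Suc k) x) + C * exp_term s c (Suc n) x) {s..x}"
      by (intro has_integral_add has_integral_mult_right has_integral_sum has_integral_exp_term[OF sx]) auto
    also have "(\<lambda>y. a * (\<Sum>k<n. c * exp_term s c k y) + C * (c * exp_term s c n y)) = (\<lambda>y. c * ?g y)"
      by (simp add: sum_distrib_left algebra_simps)
    finally have "integral {s..x} (\<lambda>y. c * ?g y) = a * (\<Sum>k<n. exp_term s c (Suc k) x) + C * exp_term s c (Suc n) x"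
      by (rule integral_unique)
    moreover have "f x \<le> a + integral {s..x} (\<lambda>y. c * ?g y)"
      using Suc by (intro step continuous_intros continuous_on_exp_term) auto
    moreover have "(\<Sum>k<Suc n. exp_term s c k x) = 1 + (\<Sum>k<n. exp_term s c (Suc k) x)"
      by (subst sum.lessThan_Suc_shift) simp
    ultimately show ?case by (simp add: distrib_left)
  qed
  have "(\<lambda>n. a * (\<Sum>k<n. exp_term s c k r) + C * exp_term s c n r) \<longlonglongrightarrow> a * exp (c * (r - s)) + C * 0"
    using exp_term_sums[of s c r]
    by (intro tendsto_intros) (auto simp: sums_def intro: summable_LIMSEQ_zero sums_summable exp_term_sums)
  then have "(\<lambda>n. a * (\<Sum>k<n. exp_term s c k r) + C * exp_term s c n r) \<longlonglongrightarrow> a * exp (c * (r - s))"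
    by simp
  then show ?thesis by (rule LIMSEQ_le_const) (use *[OF r] in auto)
qed

section \<open>The Dyson series and the integral equation\<close>

text \<open>The n-fold time-ordered integral of M; the partial sums are the Picard iterates of the
  integral equation.\<close>

primrec dyson_term :: "(real \<Rightarrow> 'n::finite superop) \<Rightarrow> real \<Rightarrow> nat \<Rightarrow> real \<Rightarrow> 'n superop" where
  "dyson_term M s 0 r = id_blinfun"
| "dyson_term M s (Suc n) r = integral {s..r} (\<lambda>x. M x o\<^sub>L dyson_term M s n x)"

lemma continuous_on_dyson_term:
  assumes "regulated_on s b M"
  shows "continuous_on {s..b} (dyson_term M s n)"
proof (induction n)
  case (Suc n)
  then show ?case
    by (simp add: indefinite_integral_continuous_1 regulated_on_compose_continuous assms)
qed simp

lemma norm_dyson_term_le: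
  assumes M: "regulated_on s b M" and B: "\<And>x. x \<in> {s..b} \<Longrightarrow> norm (M x) \<le> B"
    and r: "r \<in> {s..b}"
  shows "norm (dyson_term M s n r) \<le> exp_term s B n r"
  using r
proof (induction n arbitrary: r)
  case 0
  then show ?case by (simp add: norm_blinfun_id_le)
next
  case (Suc n)
  have "norm (integral {s..r} (\<lambda>x. M x o\<^sub>L dyson_term M s n x)) \<le> integral {s..r} (\<lambda>x. B * exp_term s B n x)"
  proof (rule integral_norm_bound_integral)
    show "(\<lambda>x. M x o\<^sub>L dyson_term M s n x) integrable_on {s..r}"
      using Suc M by (intro regulated_on_compose_continuous)
        (auto intro: regulated_on_subset continuous_on_subset continuous_on_dyson_term)
    show "(\<lambda>x. B * exp_term s B n x) integrable_on {s..r}"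
      using Suc by (intro has_integral_integrable[OF has_integral_exp_term]) auto
    fix x assume x: "x \<in> {s..r}"
    have "0 \<le> B" using B[of r] Suc norm_ge_zero[of "M r"] by linarith
    then show "norm (M x o\<^sub>L dyson_term M s n x) \<le> B * exp_term s B n x"
      using Suc x B by (intro order_trans[OF norm_blinfun_compose] mult_mono) auto
  qed
  also have "\<dots> = exp_term s B (Suc n) r"
    using Suc by (intro integral_unique has_integral_exp_term) auto
  finally show ?case by simp
qed

definition dyson_series :: "(real \<Rightarrow> 'n::finite superop) \<Rightarrow> real \<Rightarrow> real \<Rightarrow> 'n superop" where
  "dyson_series M s r = (\<Sum>n. dyson_term M s n r)"

lemma uniform_limit_dyson:
  assumes M: "regulated_on s b M"
  shows "uniform_limit {s..b} (\<lambda>n r. \<Sum>i<n. dyson_term M s i r) (dyson_series M s) sequentially"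
proof -
  obtain B where B: "0 \<le> B" "\<And>x. x \<in> {s..b} \<Longrightarrow> norm (M x) \<le> B"
    using regulated_on_bounded[OF M] by blast
  show ?thesis
    unfolding dyson_series_def
  proof (rule Weierstrass_m_test)
    fix n r assume r: "r \<in> {s..b}"
    have "norm (dyson_term M s n r) \<le> exp_term s B n r" by (rule norm_dyson_term_le[OF M B(2) r])
    also have "\<dots> \<le> exp_term s B n b" using B r by (intro exp_term_mono) auto
    finally show "norm (dyson_term M s n r) \<le> exp_term s B n b" .
  qed (rule sums_summable[OF exp_term_sums])
qed

lemma continuous_on_dyson_series:
  assumes M: "regulated_on s b M"
  shows "continuous_on {s..b} (dyson_series M s)"
  by (rule uniform_limit_theorem[OF _ uniform_limit_dyson[OF M]])
     (auto intro!: always_eventually continuous_on_sum continuous_on_dyson_term M)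

lemma dyson_series_integral:
  assumes M: "regulated_on s r M" and sr: "s \<le> r"
  shows "dyson_series M s r = id_blinfun + integral {s..r} (\<lambda>x. M x o\<^sub>L dyson_series M s x)"
proof -
  obtain B where B: "0 \<le> B" "\<And>x. x \<in> {s..r} \<Longrightarrow> norm (M x) \<le> B"
    using regulated_on_bounded[OF M] by blast
  let ?S = "\<lambda>n r. \<Sum>i<n. dyson_term M s i r"
  let ?U = "dyson_series M s"
  have contS: "continuous_on {s..r} (?S n)" for n
    by (intro continuous_on_sum continuous_on_dyson_term M)
  have intS: "(\<lambda>x. M x o\<^sub>L ?S n x) integrable_on {s..r}" for n
    by (intro regulated_on_compose_continuous M contS)
  have intU: "(\<lambda>x. M x o\<^sub>L ?U x) integrable_on {s..r}"
    by (intro regulated_on_compose_continuous M continuous_on_dyson_series)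
  have inttm: "(\<lambda>x. M x o\<^sub>L dyson_term M s i x) integrable_on {s..r}" for i
    by (intro regulated_on_compose_continuous M continuous_on_dyson_term)
  have Suc: "?S (Suc n) r = id_blinfun + integral {s..r} (\<lambda>x. M x o\<^sub>L ?S n x)" for n
  proof -
    have "?S (Suc n) r = id_blinfun + (\<Sum>i<n. integral {s..r} (\<lambda>x. M x o\<^sub>L dyson_term M s i x))"
      by (simp only: sum.lessThan_Suc_shift dyson_term.simps)
    also have "(\<Sum>i<n. integral {s..r} (\<lambda>x. M x o\<^sub>L dyson_term M s i x)) =
        integral {s..r} (\<lambda>x. \<Sum>i<n. M x o\<^sub>L dyson_term M s i x)"
      by (intro integral_sum[symmetric]) (auto simp: inttm)
    also have "(\<lambda>x. \<Sum>i<n. M x o\<^sub>L dyson_term M s i x) = (\<lambda>x. M x o\<^sub>L ?S n x)"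
      by (simp add: bounded_bilinear.sum_right[OF bounded_bilinear_blinfun_compose])
    finally show ?thesis .
  qed
  have lim: "(\<lambda>n. integral {s..r} (\<lambda>x. M x o\<^sub>L ?S n x)) \<longlonglongrightarrow> integral {s..r} (\<lambda>x. M x o\<^sub>L ?U x)"
  proof (rule tendstoI)
    fix e :: real assume "e > 0"
    \<comment> \<open>The summand 1 keeps the denominator positive when B (r - s) = 0 and makes the
      final estimate strict.\<close>
    define e' where "e' = e / (B * (r - s) + 1)"
    have pos: "B * (r - s) + 1 > 0" using B sr by (simp add: add_nonneg_pos)
    then have e': "e' > 0" using \<open>e > 0\<close> by (simp add: e'_def)
    have "\<forall>\<^sub>F n in sequentially. \<forall>x\<in>{s..r}. dist (?S n x) (?U x) < e'"
      by (rule uniform_limitD[OF uniform_limit_dyson[OF M] e'])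
    then show "\<forall>\<^sub>F n in sequentially. dist (integral {s..r} (\<lambda>x. M x o\<^sub>L ?S n x))
        (integral {s..r} (\<lambda>x. M x o\<^sub>L ?U x)) < e"
    proof eventually_elim
      case (elim n)
      have "norm (integral {s..r} (\<lambda>x. (M x o\<^sub>L ?S n x) - (M x o\<^sub>L ?U x))) \<le> integral {s..r} (\<lambda>x. B * e')"
      proof (rule integral_norm_bound_integral)
        show "(\<lambda>x. (M x o\<^sub>L ?S n x) - (M x o\<^sub>L ?U x)) integrable_on {s..r}"
          by (rule Henstock_Kurzweil_Integration.integrable_diff[OF intS intU])
        fix x assume x: "x \<in> {s..r}"
        have "norm ((M x o\<^sub>L ?S n x) - (M x o\<^sub>L ?U x)) = norm (M x o\<^sub>L (?S n x - ?U x))"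
          by (simp add: bounded_bilinear.diff_right[OF bounded_bilinear_blinfun_compose])
        also have "\<dots> \<le> norm (M x) * norm (?S n x - ?U x)" by (rule norm_blinfun_compose)
        also have "\<dots> \<le> B * e'"
          using B x elim by (intro mult_mono) (auto simp: dist_norm intro: less_imp_le)
        finally show "norm ((M x o\<^sub>L ?S n x) - (M x o\<^sub>L ?U x)) \<le> B * e'" .
      qed auto
      also have "integral {s..r} (\<lambda>x. B * e') = B * (r - s) * e'" using sr by simp
      also have "\<dots> < e"
        using pos \<open>e > 0\<close> by (simp add: e'_def divide_simps)
      finally show ?case
        by (simp add: dist_norm Henstock_Kurzweil_Integration.integral_diff intS intU)
    qed
  qed
  have "(\<lambda>n. ?S (Suc n) r) \<longlonglongrightarrow> ?U r"
    using tendsto_uniform_limitI[OF uniform_limit_dyson[OF M], of r] sr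
    by (intro LIMSEQ_Suc) auto
  moreover have "(\<lambda>n. ?S (Suc n) r) \<longlonglongrightarrow> id_blinfun + integral {s..r} (\<lambda>x. M x o\<^sub>L ?U x)"
    unfolding Suc by (intro tendsto_intros lim)
  ultimately show ?thesis by (rule LIMSEQ_unique)
qed

text \<open>Gronwall with initial constant 0 for the norm of f - g. The initial value V is arbitrary
  so that the composition law can use the lemma as well as uniqueness of the solution.\<close>

lemma integral_equation_unique:
  fixes M :: "real \<Rightarrow> 'n::finite superop"
  assumes M: "regulated_on s b M"
    and f: "continuous_on {s..b} f" "\<And>r. r \<in> {s..b} \<Longrightarrow> f r = V + integral {s..r} (\<lambda>x. M x o\<^sub>L f x)"
    and g: "continuous_on {s..b} g" "\<And>r. r \<in> {s..b} \<Longrightarrow> g r = V + integral {s..r} (\<lambda>x. M x o\<^sub>L g x)"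
    and r: "r \<in> {s..b}"
  shows "f r = g r"
proof -
  obtain B where B: "0 \<le> B" "\<And>x. x \<in> {s..b} \<Longrightarrow> norm (M x) \<le> B"
    using regulated_on_bounded[OF M] by blast
  have cont: "continuous_on {s..b} (\<lambda>x. f x - g x)" by (intro continuous_intros f g)
  obtain C where C: "\<And>x. x \<in> {s..b} \<Longrightarrow> norm (f x - g x) \<le> C"
    using regulated_on_bounded[OF continuous_on_imp_regulated_on[OF cont]] by blast
  have int: "(\<lambda>x. M x o\<^sub>L h x) integrable_on {s..r}" if "continuous_on {s..b} h" "r \<in> {s..b}" for h r
    using that M by (intro regulated_on_compose_continuous) (auto intro: regulated_on_subset continuous_on_subset)
  have "norm (f r - g r) \<le> 0 * exp (B * (r - s))"
  proof (rule gronwall[OF B(1) C _ r])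
    fix h :: "real \<Rightarrow> real" and r
    assume h: "continuous_on {s..b} h" "\<And>x. x \<in> {s..b} \<Longrightarrow> norm (f x - g x) \<le> h x" and r: "r \<in> {s..b}"
    have "f r - g r = integral {s..r} (\<lambda>x. M x o\<^sub>L f x) - integral {s..r} (\<lambda>x. M x o\<^sub>L g x)"
      by (subst f(2)[OF r], subst g(2)[OF r]) simp
    also have "\<dots> = integral {s..r} (\<lambda>x. M x o\<^sub>L (f x - g x))"
      using r f(1) g(1) by (simp add: Henstock_Kurzweil_Integration.integral_diff[symmetric] int bounded_bilinear.diff_right[OF bounded_bilinear_blinfun_compose])
    also have "norm \<dots> \<le> integral {s..r} (\<lambda>x. B * h x)"
    proof (rule integral_norm_bound_integral)
      show "(\<lambda>x. M x o\<^sub>L (f x - g x)) integrable_on {s..r}" by (rule int[OF cont r])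
      show "(\<lambda>x. B * h x) integrable_on {s..r}"
        using r by (intro integrable_continuous_real continuous_intros continuous_on_subset[OF h(1)]) auto
      fix x assume "x \<in> {s..r}"
      then show "norm (M x o\<^sub>L (f x - g x)) \<le> B * h x"
        using r B h by (intro order_trans[OF norm_blinfun_compose] mult_mono) auto
    qed
    finally show "norm (f r - g r) \<le> 0 + integral {s..r} (\<lambda>x. B * h x)" by simp
  qed
  then show ?thesis by simp
qed

text \<open>On bounded intervals only finitely many times lack the derivative, and the fundamental
  theorem of calculus tolerates finitely many exceptions for a continuous function. Conversely, the
  indefinite integral is differentiable wherever M is continuous.\<close>

lemma solves_evolution_iff_integral:
  fixes M :: "real \<Rightarrow> 'n::finite superop"
  assumes M: "piecewise_continuous M" and s: "0 \<le> s"
  shows "solves_evolution M s U \<longleftrightarrow> continuous_on {s..} U \<and>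
     (\<forall>r\<ge>s. U r = id_blinfun + integral {s..r} (\<lambda>x. M x o\<^sub>L U x))"
proof
  assume sol: "solves_evolution M s U"
  then have U: "continuous_on {s..} U" and Us: "U s = id_blinfun"
    and der: "\<And>r. r \<ge> s \<Longrightarrow> continuous (at r within {0..}) M \<Longrightarrow>
      (U has_vector_derivative (M r o\<^sub>L U r)) (at r within {s..})"
    by (auto simp: solves_evolution_def)
  have "U r = id_blinfun + integral {s..r} (\<lambda>x. M x o\<^sub>L U x)" if "r \<ge> s" for r
  proof -
    have "finite {x \<in> {0..r}. \<not> continuous (at x within {0..}) M}"
      using M by (simp add: piecewise_continuous_def)
    then have "((\<lambda>x. M x o\<^sub>L U x) has_integral U r - U s) {s..r}"
    proof (rule fundamental_theorem_of_calculus_interior_strong[OF _ that])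
      show "continuous_on {s..r} U" using U by (rule continuous_on_subset) auto
      fix x assume x: "x \<in> {s<..<r} - {x \<in> {0..r}. \<not> continuous (at x within {0..}) M}"
      then have "(U has_vector_derivative (M x o\<^sub>L U x)) (at x within {s..})"
        using s by (intro der) auto
      then have "(U has_vector_derivative (M x o\<^sub>L U x)) (at x within {s<..})"
        by (rule has_vector_derivative_within_subset) auto
      then show "(U has_vector_derivative (M x o\<^sub>L U x)) (at x)"
        using at_within_open[of x "{s<..}"] x by (simp only: open_greaterThan Diff_iff greaterThanLessThan_iff greaterThan_iff)
    qed
    then show ?thesis using Us by (simp add: integral_unique)
  qed
  then show "continuous_on {s..} U \<and> (\<forall>r\<ge>s. U r = id_blinfun + integral {s..r} (\<lambda>x. M x o\<^sub>L U x))"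
    using U by blast
next
  assume "continuous_on {s..} U \<and> (\<forall>r\<ge>s. U r = id_blinfun + integral {s..r} (\<lambda>x. M x o\<^sub>L U x))"
  then have U: "continuous_on {s..} U"
    and eq: "\<And>r. r \<ge> s \<Longrightarrow> U r = id_blinfun + integral {s..r} (\<lambda>x. M x o\<^sub>L U x)" by auto
  have "(U has_vector_derivative (M r o\<^sub>L U r)) (at r within {s..})"
    if r: "r \<ge> s" and cont: "continuous (at r within {0..}) M" for r
  proof -
    \<comment> \<open>Extending past r makes r differ from the right end, so that derivatives within
      the bounded interval and within the half-line agree at r.\<close>
    have int: "(\<lambda>x. M x o\<^sub>L U x) integrable_on {s..r + 1}"
      by (intro regulated_on_compose_continuous piecewise_continuous_regulated M s continuous_on_subset[OF U]) auto
    have "continuous (at r within {s..r + 1}) M"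
      by (rule continuous_within_subset[OF cont]) (use s in auto)
    moreover have "continuous (at r within {s..r + 1}) U"
      using continuous_on_subset[OF U, of "{s..r + 1}"] r by (auto simp: continuous_on_eq_continuous_within)
    ultimately have "continuous (at r within {s..r + 1}) (\<lambda>x. M x o\<^sub>L U x)"
      unfolding continuous_within by (rule bounded_bilinear.tendsto[OF bounded_bilinear_blinfun_compose])
    then have "((\<lambda>u. integral {s..u} (\<lambda>x. M x o\<^sub>L U x)) has_vector_derivative (M r o\<^sub>L U r)) (at r within {s..r + 1})"
      using integral_has_vector_derivative_continuous_at[OF int, of r "{}"] r by simp
    then have "((\<lambda>u. id_blinfun + integral {s..u} (\<lambda>x. M x o\<^sub>L U x)) has_vector_derivative (M r o\<^sub>L U r))
        (at r within {s..r + 1})"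
      using has_vector_derivative_add[OF has_vector_derivative_const] by fastforce
    then have "(U has_vector_derivative (M r o\<^sub>L U r)) (at r within {s..r + 1})"
      by (rule has_vector_derivative_transform[rotated 2]) (use r eq in auto)
    moreover have "at r within {s..r + 1} = at r within {s..}"
      by (rule at_within_nhd[of _ "{..<r + 1}"]) auto
    ultimately show ?thesis by simp
  qed
  then show "solves_evolution M s U"
    using U eq[of s] by (simp add: solves_evolution_def)
qed

lemma solves_evolution_unique:
  assumes "piecewise_continuous M" "0 \<le> s" "solves_evolution M s U" "solves_evolution M s V" "s \<le> r"
  shows "U r = V r"
proof (rule integral_equation_unique)
  show "regulated_on s r M" using assms by (intro piecewise_continuous_regulated)
qed (use assms in \<open>auto simp: solves_evolution_iff_integral intro: continuous_on_subset\<close>)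

lemma solves_evolution_dyson_series:
  assumes "piecewise_continuous M" "0 \<le> s"
  shows "solves_evolution M s (dyson_series M s)"
  unfolding solves_evolution_iff_integral[OF assms]
proof (intro conjI allI impI)
  have "continuous_on {s..<b} (dyson_series M s)" for b
    by (rule continuous_on_subset[OF continuous_on_dyson_series[of s b M]])
       (auto intro: piecewise_continuous_regulated assms)
  then have "continuous (at r within {s..}) (dyson_series M s)" if "r \<ge> s" for r
  proof -
    assume c: "\<And>b. continuous_on {s..<b} (dyson_series M s)"
    have "at r within {s..<r + 1} = at r within {s..}"
      by (rule at_within_nhd[of _ "{..<r + 1}"]) auto
    moreover have "continuous (at r within {s..<r + 1}) (dyson_series M s)"
      using c[of "r + 1"] that by (auto simp: continuous_on_eq_continuous_within)
    ultimately show ?thesis by simp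
  qed
  then show "continuous_on {s..} (dyson_series M s)" by (auto simp: continuous_on_eq_continuous_within)
qed (auto intro!: dyson_series_integral piecewise_continuous_regulated assms)

lemma propagator_eq:
  assumes "piecewise_continuous M" "0 \<le> s" "solves_evolution M s U" "s \<le> r"
  shows "propagator M r s = U r"
  unfolding propagator_def
  by (rule the_equality) (use assms solves_evolution_unique in blast)+

lemma
  assumes M: "piecewise_continuous M" and s: "0 \<le> s"
  shows continuous_on_propagator: "continuous_on {s..} (\<lambda>r. propagator M r s)"
    and propagator_integral: "s \<le> r \<Longrightarrow>
      propagator M r s = id_blinfun + integral {s..r} (\<lambda>x. M x o\<^sub>L propagator M x s)"
proof -
  note eq = propagator_eq[OF assms solves_evolution_dyson_series[OF assms]]
  show "continuous_on {s..} (\<lambda>r. propagator M r s)"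
    using solves_evolution_dyson_series[OF assms] eq
    by (subst continuous_on_cong[where g = "dyson_series M s"]) (auto simp: solves_evolution_def)
  assume r: "s \<le> r"
  have "integral {s..r} (\<lambda>x. M x o\<^sub>L propagator M x s) = integral {s..r} (\<lambda>x. M x o\<^sub>L dyson_series M s x)"
    by (rule integral_cong) (simp add: eq)
  then show "propagator M r s = id_blinfun + integral {s..r} (\<lambda>x. M x o\<^sub>L propagator M x s)"
    using r dyson_series_integral[of s r M] eq[OF r] piecewise_continuous_regulated[OF M s] by simp
qed

lemma integrable_propagator:
  assumes "piecewise_continuous M" "0 \<le> s" "s \<le> a"
  shows "(\<lambda>x. M x o\<^sub>L propagator M x s) integrable_on {a..b}"
  using assms
  by (intro regulated_on_compose_continuous piecewise_continuous_regulated
      continuous_on_subset[OF continuous_on_propagator]) auto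

lemma propagator_refl: "piecewise_continuous M \<Longrightarrow> 0 \<le> s \<Longrightarrow> propagator M s s = id_blinfun"
  using propagator_integral[of M s s] by simp

text \<open>Both sides, as functions of the final time on [a, b], solve the integral equation with
  the same value \<open>propagator M a s\<close> at a.\<close>

lemma propagator_compose:
  assumes M: "piecewise_continuous M" and s: "0 \<le> s" "s \<le> a" "a \<le> b"
  shows "propagator M b s = propagator M b a o\<^sub>L propagator M a s"
proof (rule integral_equation_unique[where s = a and b = b and M = M and V = "propagator M a s"
      and f = "\<lambda>r. propagator M r s" and g = "\<lambda>r. propagator M r a o\<^sub>L propagator M a s"])
  have a: "0 \<le> a" using s by simp
  show "regulated_on a b M" by (rule piecewise_continuous_regulated[OF M a])
  show "continuous_on {a..b} (\<lambda>r. propagator M r s)"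
    using s by (intro continuous_on_subset[OF continuous_on_propagator[OF M s(1)]]) auto
  have "continuous_on {a..b} (\<lambda>r. propagator M r a)"
    by (intro continuous_on_subset[OF continuous_on_propagator[OF M a]]) auto
  then show "continuous_on {a..b} (\<lambda>r. propagator M r a o\<^sub>L propagator M a s)"
    by (intro bounded_bilinear.continuous_on[OF bounded_bilinear_blinfun_compose] continuous_intros)
  show "b \<in> {a..b}" using s by simp
  fix r assume r: "r \<in> {a..b}"
  have "integral {s..a} (\<lambda>x. M x o\<^sub>L propagator M x s) + integral {a..r} (\<lambda>x. M x o\<^sub>L propagator M x s)
      = integral {s..r} (\<lambda>x. M x o\<^sub>L propagator M x s)"
    using r s by (intro Henstock_Kurzweil_Integration.integral_combine integrable_propagator M) auto
  then show "propagator M r s = propagator M a s + integral {a..r} (\<lambda>x. M x o\<^sub>L propagator M x s)"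
    using propagator_integral[OF M s(1), of r] propagator_integral[OF M s(1), of a] r s
    by (simp add: add.assoc)
  have lin: "bounded_linear (\<lambda>X. X o\<^sub>L propagator M a s)"
    by (rule bounded_bilinear.bounded_linear_left[OF bounded_bilinear_blinfun_compose])
  have "propagator M r a o\<^sub>L propagator M a s = propagator M a s
      + (integral {a..r} (\<lambda>x. M x o\<^sub>L propagator M x a) o\<^sub>L propagator M a s)"
    using propagator_integral[OF M a, of r] r
    by (simp add: blinfun_compose_id_left bounded_bilinear.add_left[OF bounded_bilinear_blinfun_compose])
  also have "integral {a..r} (\<lambda>x. M x o\<^sub>L propagator M x a) o\<^sub>L propagator M a s =
      integral {a..r} (\<lambda>x. M x o\<^sub>L propagator M x a o\<^sub>L propagator M a s)"
    using integral_linear[OF integrable_propagator[OF M a order.refl] lin, of r] by (simp add: o_def)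
  finally show "propagator M r a o\<^sub>L propagator M a s = propagator M a s
      + integral {a..r} (\<lambda>x. M x o\<^sub>L (propagator M x a o\<^sub>L propagator M a s))"
    by (simp add: blinfun_compose_assoc)
qed

text \<open>Bootstrapping through the integral equation: Gronwall bounds U, this bounds U - 1 as the
  integral of M U, and that bounds the remainder, which is the integral of M (U - 1). Each bound is
  the scalar one for a constant generator c.\<close>

lemma
  fixes M :: "real \<Rightarrow> 'n::finite superop"
  assumes M: "piecewise_continuous M" and s: "0 \<le> s" "s \<le> r"
    and c: "\<And>x. x \<in> {s..r} \<Longrightarrow> norm_1to1 (M x) \<le> c"
  shows norm_1to1_propagator_le: "norm_1to1 (propagator M r s) \<le> exp (c * (r - s))"
    and norm_1to1_propagator_remainder_le:
      "norm_1to1 (propagator M r s - id_blinfun - integral {s..r} M) \<le> exp (c * (r - s)) - 1 - c * (r - s)"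
proof -
  let ?U = "\<lambda>x. propagator M x s"
  have c0: "0 \<le> c" using c[of r] s norm_1to1_nonneg[of "M r"] by auto
  have int: "((\<lambda>x. M x o\<^sub>L ?U x) has_integral ?U y - id_blinfun) {s..y}" if "y \<in> {s..r}" for y
    using that propagator_integral[OF M s(1), of y]
    by (simp add: integrable_integral integrable_propagator[OF M s(1) order.refl])
  have U: "norm_1to1 (?U y) \<le> exp (c * (y - s))" if y: "y \<in> {s..r}" for y
  proof -
    \<comment> \<open>Equivalence of norms serves only for the a priori bound k B that starts
      Gronwall; neither constant survives.\<close>
    obtain k where k: "k > 0" "\<And>T :: 'n superop. norm_1to1 T \<le> k * norm T"
      using norm_1to1_le_norm by blast
    obtain B where B: "\<And>x. x \<in> {s..r} \<Longrightarrow> norm (?U x) \<le> B"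
      using regulated_on_bounded[OF continuous_on_imp_regulated_on, of s r ?U]
        continuous_on_subset[OF continuous_on_propagator[OF M s(1)], of "{s..r}"] by auto
    have "norm_1to1 (?U y) \<le> 1 * exp (c * (y - s))"
    proof (rule gronwall[OF c0 _ _ y])
      show "norm_1to1 (?U x) \<le> k * B" if "x \<in> {s..r}" for x
        using that k B by (meson mult_left_mono less_imp_le order_trans)
      fix h :: "real \<Rightarrow> real" and y
      assume h: "continuous_on {s..r} h" "\<And>x. x \<in> {s..r} \<Longrightarrow> norm_1to1 (?U x) \<le> h x" and y: "y \<in> {s..r}"
      have "norm_1to1 (?U y - id_blinfun) \<le> integral {s..y} (\<lambda>x. c * h x)"
      proof (rule norm_1to1_has_integral_le[OF int[OF y]])
        show "((\<lambda>x. c * h x) has_integral integral {s..y} (\<lambda>x. c * h x)) {s..y}"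
          using y by (intro integrable_integral integrable_continuous_real continuous_intros
              continuous_on_subset[OF h(1)]) auto
        fix x assume x: "x \<in> {s..y}"
        then show "norm_1to1 (M x o\<^sub>L ?U x) \<le> c * h x"
          using y c h c0 by (intro order_trans[OF norm_1to1_compose] mult_mono norm_1to1_nonneg) auto
      qed
      then show "norm_1to1 (?U y) \<le> 1 + integral {s..y} (\<lambda>x. c * h x)"
        using norm_1to1_triangle[of "?U y - id_blinfun" id_blinfun] norm_1to1_id[where 'a = 'n] by simp
    qed
    then show ?thesis by simp
  qed
  then show "norm_1to1 (propagator M r s) \<le> exp (c * (r - s))" using s by simp
  have U1: "norm_1to1 (?U y - id_blinfun) \<le> exp (c * (y - s)) - 1" if y: "y \<in> {s..r}" for y
  proof (rule norm_1to1_has_integral_le[OF int[OF y] has_integral_exp])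
    fix x assume x: "x \<in> {s..y}"
    then show "norm_1to1 (M x o\<^sub>L ?U x) \<le> c * exp (c * (x - s))"
      using y c U c0 by (intro order_trans[OF norm_1to1_compose] mult_mono norm_1to1_nonneg) auto
  qed (use y in auto)
  have intM: "(M has_integral integral {s..r} M) {s..r}"
    by (intro integrable_integral regulated_on_integrable piecewise_continuous_regulated M s)
  have "((\<lambda>x. M x o\<^sub>L (?U x - id_blinfun)) has_integral ?U r - id_blinfun - integral {s..r} M) {s..r}"
    using has_integral_diff[OF int intM] s
    by (simp add: blinfun_compose_id_right bounded_bilinear.diff_right[OF bounded_bilinear_blinfun_compose])
  moreover have "((\<lambda>x. c * exp (c * (x - s)) - c) has_integral exp (c * (r - s)) - 1 - c * (r - s)) {s..r}"
    using s has_integral_diff[OF has_integral_exp[OF s(2)] has_integral_const_real[of c s r]]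
    by (simp add: mult.commute)
  ultimately show "norm_1to1 (propagator M r s - id_blinfun - integral {s..r} M) \<le> exp (c * (r - s)) - 1 - c * (r - s)"
  proof (rule norm_1to1_has_integral_le)
    fix x assume x: "x \<in> {s..r}"
    then have "norm_1to1 (M x o\<^sub>L (?U x - id_blinfun)) \<le> c * (exp (c * (x - s)) - 1)"
      using c U1 c0 by (intro order_trans[OF norm_1to1_compose] mult_mono norm_1to1_nonneg) auto
    then show "norm_1to1 (M x o\<^sub>L (?U x - id_blinfun)) \<le> c * exp (c * (x - s)) - c"
      by (simp add: right_diff_distrib)
  qed
qed

section \<open>Error of a Trotter step\<close>

text \<open>The difference of the two sides vanishes at 0 and has derivative (1 - (1 - x) exp x) +
  x^2 / 2 exp x, nonnegative because 1 - x \<le> exp (- x).\<close>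

lemma exp_remainder_le:
  fixes y :: real
  assumes "0 \<le> y"
  shows "exp y - 1 - y \<le> y\<^sup>2 / 2 * exp y"
proof -
  let ?f = "\<lambda>y::real. y\<^sup>2 / 2 * exp y - exp y + 1 + y"
  have "?f 0 \<le> ?f y"
  proof (rule DERIV_nonneg_imp_nondecreasing[OF assms])
    fix x :: real assume x: "0 \<le> x" "x \<le> y"
    have "(?f has_real_derivative x * exp x + x\<^sup>2 / 2 * exp x - exp x + 1) (at x)"
      by (auto intro!: derivative_eq_intros)
    moreover have "(1 - x) * exp x \<le> exp (- x) * exp x"
      using exp_ge_add_one_self[of "- x"] by (intro mult_right_mono) auto
    then have "0 \<le> (1 - (1 - x) * exp x) + x\<^sup>2 / 2 * exp x"
      by (intro add_nonneg_nonneg) (auto simp: exp_minus)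
    then have "0 \<le> x * exp x + x\<^sup>2 / 2 * exp x - exp x + 1" by (simp add: algebra_simps)
    ultimately show "\<exists>z. (?f has_real_derivative z) (at x) \<and> 0 \<le> z" by blast
  qed
  then show ?thesis by simp
qed

lemma norm_1to1_integral_le:
  assumes "regulated_on s r M" "s \<le> r" "\<And>x. x \<in> {s..r} \<Longrightarrow> norm_1to1 (M x) \<le> c"
  shows "norm_1to1 (integral {s..r} M) \<le> c * (r - s)"
  using norm_1to1_has_integral_le[OF integrable_integral[OF regulated_on_integrable[OF assms(1)]]
      has_integral_const_real[of c s r]] assms(2,3) by (simp add: mult.commute)

lemma norm_1to1_ordered_prod_le:
  assumes "\<And>i. i \<in> {1..n} \<Longrightarrow> norm_1to1 (X i) \<le> exp (y i)"
  shows "norm_1to1 (ordered_prod X n) \<le> exp (\<Sum>i=1..n. y i)"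
  using assms
proof (induction n)
  case 0
  then show ?case by (simp add: norm_1to1_id)
next
  case (Suc n)
  have "norm_1to1 (ordered_prod X (Suc n)) \<le> norm_1to1 (X (Suc n)) * norm_1to1 (ordered_prod X n)"
    by (simp add: norm_1to1_compose)
  also have "\<dots> \<le> exp (y (Suc n)) * exp (\<Sum>i=1..n. y i)"
    using Suc by (intro mult_mono norm_1to1_nonneg) auto
  finally show ?case by (simp add: exp_add mult.commute)
qed

text \<open>The scalar remainder exp (n d) - 1 - n d obeys exactly the recursion that the product
  satisfies when a factor is split off, so no constant is lost in the induction.\<close>

lemma ordered_prod_second_order:
  fixes X A :: "nat \<Rightarrow> 'n::finite superop"
  assumes X: "\<And>i. i \<in> {1..n} \<Longrightarrow> norm_1to1 (X i) \<le> exp d"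
    and A: "\<And>i. i \<in> {1..n} \<Longrightarrow> norm_1to1 (A i) \<le> d"
    and R: "\<And>i. i \<in> {1..n} \<Longrightarrow> norm_1to1 (X i - id_blinfun - A i) \<le> exp d - 1 - d"
  shows "norm_1to1 (ordered_prod X n - id_blinfun - (\<Sum>i=1..n. A i))
      \<le> exp (real n * d) - 1 - real n * d"
proof -
  \<comment> \<open>The first-order estimate is carried along because the new term A meets P - 1 in
    the second-order step.\<close>
  have "norm_1to1 (ordered_prod X n - id_blinfun) \<le> exp (real n * d) - 1 \<and>
    norm_1to1 (ordered_prod X n - id_blinfun - (\<Sum>i=1..n. A i)) \<le> exp (real n * d) - 1 - real n * d"
    using assms
  proof (induction n)
    case 0
    then show ?case by simp
  next
    case (Suc n)
    let ?P = "ordered_prod X n" and ?X = "X (Suc n)" and ?A = "A (Suc n)" and ?S = "\<Sum>i=1..n. A i"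
    let ?e = "exp (real n * d)"
    have IH: "norm_1to1 (?P - id_blinfun) \<le> ?e - 1"
      "norm_1to1 (?P - id_blinfun - ?S) \<le> ?e - 1 - real n * d"
      using Suc by auto
    have P: "norm_1to1 ?P \<le> ?e"
      using norm_1to1_ordered_prod_le[of n X "\<lambda>_. d"] Suc by simp
    have XA: "norm_1to1 ?A \<le> d" "norm_1to1 (?X - id_blinfun - ?A) \<le> exp d - 1 - d"
      using Suc by auto
    have d0: "0 \<le> d" using XA norm_1to1_nonneg[of ?A] by linarith
    have R0: "0 \<le> exp d - 1 - d" using exp_ge_add_one_self[of d] by linarith
    have "(?X o\<^sub>L ?P) - id_blinfun - (?S + ?A) =
        ((?X - id_blinfun - ?A) o\<^sub>L ?P) + (?A o\<^sub>L (?P - id_blinfun)) + (?P - id_blinfun - ?S)"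
      by (simp add: bounded_bilinear.diff_left[OF bounded_bilinear_blinfun_compose]
          bounded_bilinear.diff_right[OF bounded_bilinear_blinfun_compose]
          blinfun_compose_id_left blinfun_compose_id_right)
    also have "norm_1to1 \<dots> \<le> norm_1to1 ((?X - id_blinfun - ?A) o\<^sub>L ?P) + norm_1to1 (?A o\<^sub>L (?P - id_blinfun))
        + norm_1to1 (?P - id_blinfun - ?S)"
      by (meson add_mono norm_1to1_triangle order.refl order_trans)
    also have "\<dots> \<le> (exp d - 1 - d) * ?e + d * (?e - 1) + (?e - 1 - real n * d)"
      using IH P XA d0 R0
      by (intro add_mono order_trans[OF norm_1to1_compose] mult_mono norm_1to1_nonneg) auto
    also have "\<dots> = exp (real (Suc n) * d) - 1 - real (Suc n) * d"
      by (simp add: algebra_simps exp_add)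
    finally have 2: "norm_1to1 ((?X o\<^sub>L ?P) - id_blinfun - (?S + ?A)) \<le> exp (real (Suc n) * d) - 1 - real (Suc n) * d" .
    have "norm_1to1 (\<Sum>i=1..Suc n. A i) \<le> (\<Sum>i=1..Suc n. d)"
      using Suc.prems by (intro order_trans[OF norm_1to1_sum] sum_mono) auto
    then have "norm_1to1 (?S + ?A) \<le> real (Suc n) * d" by simp
    then have "norm_1to1 ((?X o\<^sub>L ?P) - id_blinfun) \<le> exp (real (Suc n) * d) - 1"
      using norm_1to1_triangle[of "(?X o\<^sub>L ?P) - id_blinfun - (?S + ?A)" "?S + ?A"] 2 by simp
    with 2 show ?case by simp
  qed
  then show ?thesis by blast
qed

text \<open>Telescoping, with X to the right and Y to the left of the exchanged factor l + 1; hence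
  the inner sum begins at l + 2. The norm of the X part is kept as it stands, to be estimated later
  jointly with the exponential.\<close>

lemma ordered_prod_diff_le:
  fixes X Y :: "nat \<Rightarrow> 'n::finite superop"
  assumes Y: "\<And>i. i \<in> {1..n} \<Longrightarrow> norm_1to1 (Y i) \<le> exp (y i)"
    and XY: "\<And>i. i \<in> {1..n} \<Longrightarrow> norm_1to1 (X i - Y i) \<le> e"
  shows "norm_1to1 (ordered_prod X n - ordered_prod Y n)
    \<le> (\<Sum>l<n. exp (\<Sum>i=l+2..n. y i) * (e * norm_1to1 (ordered_prod X l)))"
  using assms
proof (induction n)
  case 0
  then show ?case by simp
next
  case (Suc n)
  let ?P = "ordered_prod X n" and ?Q = "ordered_prod Y n"
  let ?t = "\<lambda>n l. exp (\<Sum>i=l+2..n. y i) * (e * norm_1to1 (ordered_prod X l))"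
  have "(X (Suc n) o\<^sub>L ?P) - (Y (Suc n) o\<^sub>L ?Q) = (Y (Suc n) o\<^sub>L (?P - ?Q)) + ((X (Suc n) - Y (Suc n)) o\<^sub>L ?P)"
    by (simp add: bounded_bilinear.diff_left[OF bounded_bilinear_blinfun_compose]
        bounded_bilinear.diff_right[OF bounded_bilinear_blinfun_compose])
  then have "norm_1to1 (ordered_prod X (Suc n) - ordered_prod Y (Suc n)) \<le>
      norm_1to1 (Y (Suc n)) * norm_1to1 (?P - ?Q) + norm_1to1 (X (Suc n) - Y (Suc n)) * norm_1to1 ?P"
    by (simp add: order_trans[OF norm_1to1_triangle] add_mono norm_1to1_compose)
  also have "\<dots> \<le> exp (y (Suc n)) * (\<Sum>l<n. ?t n l) + e * norm_1to1 ?P"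
    using Suc order_trans[OF norm_1to1_nonneg Suc.prems(2)[of "Suc n"]] by (intro add_mono mult_mono norm_1to1_nonneg) auto
  also have "exp (y (Suc n)) * (\<Sum>l<n. ?t n l) = (\<Sum>l<n. ?t (Suc n) l)"
    unfolding sum_distrib_left
  proof (intro sum.cong refl)
    fix l assume "l \<in> {..<n}"
    then have "(\<Sum>i=l+2..Suc n. y i) = (\<Sum>i=l+2..n. y i) + y (Suc n)" by simp
    then show "exp (y (Suc n)) * ?t n l = ?t (Suc n) l" by (simp only: exp_add mult_ac)
  qed
  also have "e * norm_1to1 ?P = ?t (Suc n) n" by simp
  also have "(\<Sum>l<n. ?t (Suc n) l) + ?t (Suc n) n = (\<Sum>l<Suc n. ?t (Suc n) l)" by simp
  finally show ?case .
qed

text \<open>Both propagations equal 1 plus the integral of L up to the same remainder with argument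
  K d: for L because its norm is at most K c, for the product by the second-order lemma. The two
  halves of y^2 exp y add up.\<close>

lemma trotter_step_error:
  fixes L :: "real \<Rightarrow> 'n::finite superop"
  assumes L: "piecewise_continuous L" and Li: "\<And>i. i \<in> {1..K} \<Longrightarrow> piecewise_continuous (Li i)"
    and sum: "\<And>s. s \<ge> 0 \<Longrightarrow> L s = (\<Sum>i=1..K. Li i s)"
    and s: "0 \<le> s" "s \<le> r"
    and c: "\<And>i x. i \<in> {1..K} \<Longrightarrow> x \<in> {s..r} \<Longrightarrow> norm_1to1 (Li i x) \<le> c" and c0: "0 \<le> c"
  shows "norm_1to1 (propagator L r s - ordered_prod (\<lambda>i. propagator (Li i) r s) K)
    \<le> (real K * (c * (r - s)))\<^sup>2 * exp (real K * (c * (r - s)))"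
proof -
  define d where "d = c * (r - s)"
  let ?A = "\<lambda>i. integral {s..r} (Li i)"
  let ?R = "exp (real K * d) - 1 - real K * d"
  have d0: "0 \<le> d" using c0 s by (simp add: d_def)
  have reg: "regulated_on s r (Li i)" if "i \<in> {1..K}" for i
    using that by (intro piecewise_continuous_regulated Li s)
  have "norm_1to1 (ordered_prod (\<lambda>i. propagator (Li i) r s) K - id_blinfun - (\<Sum>i=1..K. ?A i)) \<le> ?R"
    unfolding d_def
  proof (rule ordered_prod_second_order)
    fix i assume i: "i \<in> {1..K}"
    show "norm_1to1 (propagator (Li i) r s) \<le> exp (c * (r - s))"
      by (rule norm_1to1_propagator_le[OF Li[OF i] s c[OF i]])
    show "norm_1to1 (integral {s..r} (Li i)) \<le> c * (r - s)"
      by (rule norm_1to1_integral_le[OF reg[OF i] s(2) c[OF i]])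
    show "norm_1to1 (propagator (Li i) r s - id_blinfun - integral {s..r} (Li i)) \<le> exp (c * (r - s)) - 1 - c * (r - s)"
      by (rule norm_1to1_propagator_remainder_le[OF Li[OF i] s c[OF i]])
  qed
  moreover have "norm_1to1 (propagator L r s - id_blinfun - integral {s..r} L) \<le> ?R"
  proof -
    have "norm_1to1 (L x) \<le> real K * c" if "x \<in> {s..r}" for x
    proof -
      have "norm_1to1 (L x) \<le> (\<Sum>i=1..K. norm_1to1 (Li i x))"
        using that s norm_1to1_sum[of "\<lambda>i. Li i x" "{1..K}"] by (simp add: sum)
      also have "\<dots> \<le> (\<Sum>i=1..K. c)"
        using that by (intro sum_mono c)
      finally show ?thesis by simp
    qed
    from norm_1to1_propagator_remainder_le[OF L s this] show ?thesis by (simp add: d_def mult.assoc)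
  qed
  moreover have "integral {s..r} L = (\<Sum>i=1..K. ?A i)"
  proof -
    have "integral {s..r} L = integral {s..r} (\<lambda>x. \<Sum>i=1..K. Li i x)"
      using s by (intro integral_cong) (auto simp: sum)
    also have "\<dots> = (\<Sum>i=1..K. ?A i)"
      by (intro integral_sum regulated_on_integrable reg) auto
    finally show ?thesis .
  qed
  moreover have "norm_1to1 (propagator L r s - ordered_prod (\<lambda>i. propagator (Li i) r s) K) \<le>
      norm_1to1 (propagator L r s - id_blinfun - (\<Sum>i=1..K. ?A i)) +
      norm_1to1 (ordered_prod (\<lambda>i. propagator (Li i) r s) K - id_blinfun - (\<Sum>i=1..K. ?A i))"
    using norm_1to1_triangle_diff[of "propagator L r s - id_blinfun - (\<Sum>i=1..K. ?A i)"
        "ordered_prod (\<lambda>i. propagator (Li i) r s) K - id_blinfun - (\<Sum>i=1..K. ?A i)"]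
    by simp
  ultimately have "norm_1to1 (propagator L r s - ordered_prod (\<lambda>i. propagator (Li i) r s) K) \<le> ?R + ?R"
    by (simp only:)
  also have "\<dots> \<le> (real K * d)\<^sup>2 * exp (real K * d)"
    using exp_remainder_le[of "real K * d"] d0 by (simp add: mult.commute)
  finally show ?thesis by (simp add: d_def)
qed

text \<open>The content is boundedness: \<open>beta\<close> is an upper bound only because the
  regulated terms are bounded on [0, t].\<close>

lemma norm_1to1_le_beta:
  fixes Li :: "nat \<Rightarrow> real \<Rightarrow> 'n::finite superop"
  assumes Li: "\<And>i. i \<in> {1..K} \<Longrightarrow> piecewise_continuous (Li i)"
    and i: "i \<in> {1..K}" and s: "s \<in> {0..t}"
  shows "norm_1to1 (Li i s) \<le> beta K Li t"
proof -
  obtain k where k: "k > 0" "\<And>T :: 'n superop. norm_1to1 T \<le> k * norm T"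
    using norm_1to1_le_norm by blast
  have "\<exists>B. \<forall>x\<in>{0..t}. norm (Li i x) \<le> B" if "i \<in> {1..K}" for i
    using regulated_on_bounded[OF piecewise_continuous_regulated[OF Li[OF that] order.refl]] by metis
  then obtain B where B: "\<And>i x. i \<in> {1..K} \<Longrightarrow> x \<in> {0..t} \<Longrightarrow> norm (Li i x) \<le> B i" by metis
  have fin: "finite ((\<lambda>i. norm_1to1 (Li i x)) ` {1..K})" "(\<lambda>i. norm_1to1 (Li i x)) ` {1..K} \<noteq> {}" for x
    using i by auto
  have bdd: "bdd_above ((\<lambda>s. MAX i\<in>{1..K}. norm_1to1 (Li i s)) ` {0..t})"
  proof (rule bdd_aboveI2)
    fix x assume x: "x \<in> {0..t}"
    show "(MAX i\<in>{1..K}. norm_1to1 (Li i x)) \<le> (MAX i\<in>{1..K}. k * B i)"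
    proof (rule Max.boundedI[OF fin])
      fix a assume "a \<in> (\<lambda>i. norm_1to1 (Li i x)) ` {1..K}"
      then obtain j where j: "j \<in> {1..K}" "a = norm_1to1 (Li j x)" by blast
      have "a \<le> k * B j" unfolding j(2)
        by (rule order_trans[OF k(2)]) (use B[OF j(1) x] k(1) in simp)
      also have "\<dots> \<le> (MAX i\<in>{1..K}. k * B i)" using j by (intro Max_ge) auto
      finally show "a \<le> (MAX i\<in>{1..K}. k * B i)" .
    qed
  qed
  have "norm_1to1 (Li i s) \<le> (MAX i\<in>{1..K}. norm_1to1 (Li i s))" using i by (intro Max_ge) auto
  also have "\<dots> \<le> beta K Li t" unfolding beta_def by (rule cSUP_upper[OF s bdd])
  finally show ?thesis .
qed

section \<open>Counting indivisible steps on two grids\<close>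

lemma ex_descent:
  assumes "P x" "\<not> P y" "x \<le> (y::nat)"
  shows "\<exists>j. x \<le> j \<and> j < y \<and> P j \<and> \<not> P (Suc j)"
  using assms(3,2)
proof (induction y rule: dec_induct)
  case base
  then show ?case using assms(1) by simp
next
  case (step n)
  then show ?case by (cases "P n") (auto intro: less_SucI)
qed

text \<open>Telescoping of the indicator of b. Needed because \<open>C_count\<close> records only
  changes from channel to non-channel, while a mixed block may contain only a change in the other
  direction.\<close>

lemma card_descents_ascents:
  "card {j\<in>{1..N}. b j \<and> \<not> b (Suc j)} + of_bool (b (Suc N)) =
   card {j\<in>{1..N}. \<not> b j \<and> b (Suc j)} + of_bool (b 1)"
proof (induction N)
  case (Suc N)
  have *: "card {j\<in>{1..Suc N}. P j} = card {j\<in>{1..N}. P j} + of_bool (P (Suc N))" for P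
  proof -
    have "{j\<in>{1..Suc N}. P j} = {j\<in>{1..N}. P j} \<union> (if P (Suc N) then {Suc N} else {})"
      by (auto simp: le_Suc_eq)
    also have "card \<dots> = card {j\<in>{1..N}. P j} + of_bool (P (Suc N))"
      by (subst card_Un_disjoint) auto
    finally show ?thesis .
  qed
  show ?case
    using Suc.IH unfolding * by (cases "b (Suc N)"; cases "b (Suc (Suc N))") simp_all
qed simp

text \<open>
  A block of \<open>n\<close> consecutive indices that meets \<open>b\<close> is contained in \<open>b\<close>, or contains an ascent of
  \<open>b\<close>, or contains a descent; the numbers of ascents and descents differ by at most one.
\<close>

lemma card_blocks_le:
  fixes b B :: "nat \<Rightarrow> bool"
  assumes n: "0 < n" and m: "0 < m"
    and B: "\<And>q. q \<in> {1..m} \<Longrightarrow> B q \<Longrightarrow> \<exists>j\<in>{(q - 1) * n + 1..q * n}. b j"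
  shows "n * card {q\<in>{l+1..m}. B q} \<le> card {j\<in>{l*n+1..m*n}. b j}
    + n * (2 * card {j\<in>{1..m*n-1}. \<not> b j \<and> b (Suc j)} + 1)"
proof -
  define block where "block q = {(q - 1) * n + 1..q * n}" for q
  define up where "up = {j\<in>{1..m*n-1}. \<not> b j \<and> b (Suc j)}"
  define down where "down = {j\<in>{1..m*n-1}. b j \<and> \<not> b (Suc j)}"
  \<comment> \<open>Number of the block that contains j. It turns changes inside blocks into block
    numbers, so mixed blocks are at most as many as changes.\<close>
  define idx where "idx j = (j - 1) div n + 1" for j
  have idx: "idx j = q" if "j \<in> block q" "1 \<le> q" for j q
  proof -
    have "n * (q - 1) \<le> j - 1" "j - 1 < n * Suc (q - 1)"
      using that n by (auto simp: block_def mult.commute)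
    then have "(j - 1) div n = q - 1" by (rule div_nat_eqI)
    then show ?thesis using that by (simp add: idx_def)
  qed
  have block_sub: "block q \<subseteq> {l*n+1..m*n}" if "q \<in> {l+1..m}" for q
  proof -
    have "l * n \<le> (q - 1) * n" "q * n \<le> m * n" using that by (auto intro: mult_right_mono)
    then show ?thesis unfolding block_def atLeastatMost_subset_iff by linarith
  qed
  define full where "full = {q\<in>{l+1..m}. block q \<subseteq> Collect b}"
  have "{q\<in>{l+1..m}. B q} \<subseteq> full \<union> idx ` up \<union> idx ` down"
  proof
    fix q assume q: "q \<in> {q\<in>{l+1..m}. B q}"
    then obtain x where x: "x \<in> block q" "b x" using B[of q] by (auto simp: block_def)
    show "q \<in> full \<union> idx ` up \<union> idx ` down"
    proof (cases "block q \<subseteq> Collect b")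
      case True
      then show ?thesis using q by (simp add: full_def)
    next
      case False
      then obtain y where y: "y \<in> block q" "\<not> b y" by blast
      \<comment> \<open>Both j and its successor must lie in block q: the change is then interior,
        and \<open>idx\<close> recovers q from it.\<close>
      have "\<exists>j. j \<in> block q \<and> Suc j \<in> block q \<and> j \<in> up \<union> down"
      proof -
        have in_range: "j \<in> {1..m*n-1}" if "j \<in> block q" "Suc j \<in> block q" for j
        proof -
          have "Suc j \<in> {l*n+1..m*n}" "j \<in> {l*n+1..m*n}" using block_sub[of q] q that by auto
          then show ?thesis by auto
        qed
        have mid: "j \<in> block q" if "u \<in> block q" "v \<in> block q" "u \<le> j" "j \<le> v" for u v j
          using that by (auto simp: block_def)
        consider "x \<le> y" | "y \<le> x" by linarith
        then show ?thesis
        proof cases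
          case 1
          obtain j where "x \<le> j" "j < y" "b j" "\<not> b (Suc j)"
            using ex_descent[OF x(2) y(2) 1] by blast
          then show ?thesis
            using mid[OF x(1) y(1), of j] mid[OF x(1) y(1), of "Suc j"] in_range[of j]
            by (intro exI[of _ j]) (auto simp: down_def)
        next
          case 2
          obtain j where "y \<le> j" "j < x" "\<not> b j" "b (Suc j)"
            using ex_descent[of "\<lambda>j. \<not> b j", OF y(2) _ 2] x(2) by blast
          then show ?thesis
            using mid[OF y(1) x(1), of j] mid[OF y(1) x(1), of "Suc j"] in_range[of j]
            by (intro exI[of _ j]) (auto simp: up_def)
        qed
      qed
      then obtain j where "j \<in> block q" "j \<in> up \<union> down" by blast
      then show ?thesis using idx[of j q] q by auto
    qed
  qed
  moreover have fin: "finite full" "finite up" "finite down" by (auto simp: full_def up_def down_def)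
  ultimately have "card {q\<in>{l+1..m}. B q} \<le> card (full \<union> idx ` up \<union> idx ` down)"
    by (intro card_mono) auto
  also have "\<dots> \<le> card full + card (idx ` up) + card (idx ` down)"
    by (meson add_mono card_Un_le order.refl order_trans)
  also have "\<dots> \<le> card full + card up + card down"
    using fin by (intro add_mono card_image_le) auto
  also have "card down \<le> card up + 1"
    using card_descents_ascents[of "m * n - 1" b] unfolding up_def down_def
    by (auto simp: of_bool_def split: if_splits)
  finally have "card {q\<in>{l+1..m}. B q} \<le> card full + card up + (card up + 1)" by simp
  then have "n * card {q\<in>{l+1..m}. B q} \<le> n * (card full + card up + (card up + 1))"
    by (rule mult_le_mono2)
  also have "\<dots> = n * card full + n * (2 * card up + 1)"
    by (simp add: algebra_simps)
  \<comment> \<open>The full blocks are disjoint sets of n indices each, all inside b.\<close>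
  also have "n * card full = card (\<Union>q\<in>full. block q)"
  proof -
    have "card (block q) = n" if "q \<in> full" for q
    proof -
      have "1 \<le> q" using that by (auto simp: full_def)
      then show ?thesis by (cases q) (auto simp: block_def)
    qed
    moreover have "block q \<inter> block q' = {}" if "q \<in> full" "q' \<in> full" "q \<noteq> q'" for q q'
    proof -
      have "1 \<le> q" "1 \<le> q'" using that by (auto simp: full_def)
      then show ?thesis using idx that(3) unfolding disjoint_iff by metis
    qed
    ultimately show ?thesis
      using fin(1) by (subst card_UN_disjoint) (auto simp: block_def)
  qed
  also have "\<dots> \<le> card {j\<in>{l*n+1..m*n}. b j}"
    by (intro card_mono) (simp, use block_sub in \<open>unfold full_def, blast\<close>)
  finally show ?thesis by (simp add: up_def)
qed

section \<open>Propagation of the error\<close>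

lemma quantum_channel_propagator_chain:
  fixes M :: "real \<Rightarrow> 'n::finite superop" and \<tau> :: "nat \<Rightarrow> real"
  assumes M: "piecewise_continuous M" and mono: "\<And>i j. i \<le> j \<Longrightarrow> \<tau> i \<le> \<tau> j" and a: "0 \<le> \<tau> a"
    and ch: "\<And>j. j \<in> {a+1..c} \<Longrightarrow> quantum_channel (propagator M (\<tau> j) (\<tau> (j - 1)))"
    and ac: "a \<le> c"
  shows "quantum_channel (propagator M (\<tau> c) (\<tau> a))"
  using ac ch
proof (induction c rule: dec_induct)
  case base
  then show ?case by (simp add: propagator_refl M a quantum_channel_id)
next
  case (step c)
  have "quantum_channel (propagator M (\<tau> c) (\<tau> a))" using step by auto
  moreover have "quantum_channel (propagator M (\<tau> (Suc c)) (\<tau> c))" using step by (force dest: step.prems)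
  moreover have "propagator M (\<tau> (Suc c)) (\<tau> a) = propagator M (\<tau> (Suc c)) (\<tau> c) o\<^sub>L propagator M (\<tau> c) (\<tau> a)"
    using step mono by (intro propagator_compose M a) auto
  ultimately show ?case by (simp add: quantum_channel_compose)
qed

lemma ordered_prod_propagator:
  fixes M :: "real \<Rightarrow> 'n::finite superop"
  assumes M: "piecewise_continuous M" and t: "0 \<le> t"
  shows "ordered_prod (\<lambda>j. propagator M (t * real j / real m) (t * (real j - 1) / real m)) l
    = propagator M (t * real l / real m) 0"
proof (induction l)
  case 0
  then show ?case by (simp add: propagator_refl M)
next
  case (Suc l)
  have "propagator M (t * real (Suc l) / real m) 0 = propagator M (t * real (Suc l) / real m) (t * real l / real m)
      o\<^sub>L propagator M (t * real l / real m) 0"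
    using t by (intro propagator_compose M) (auto intro!: divide_right_mono mult_left_mono)
  then show ?case by (simp add: Suc)
qed

lemma Ch_eq_1_iff: "Ch T = 1 \<longleftrightarrow> \<not> quantum_channel T"
  and Ch_eq_0_iff: "Ch T = 0 \<longleftrightarrow> quantum_channel T"
  by (simp_all add: Ch_def)

lemma sum_Ch_eq_card: "finite A \<Longrightarrow> (\<Sum>j\<in>A. Ch (f j)) = card {j\<in>A. Ch (f j) = 1}"
proof -
  assume A: "finite A"
  have "(\<Sum>j\<in>A. Ch (f j)) = (\<Sum>j\<in>A. if Ch (f j) = 1 then 1 else 0)"
    by (intro sum.cong) (auto simp: Ch_def)
  also have "\<dots> = card {j\<in>A. Ch (f j) = 1}"
    using A by (simp add: sum.inter_filter[symmetric])
  finally show ?thesis .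
qed

text \<open>Coarse steps after l and fine steps before l n cover [0, t] once. A fine step weighs 1 /
  n, its length relative to a coarse one, so the total is governed by a single fine count over
  [0, t]; the slack comes from coarse steps that mix both kinds of fine step.\<close>

lemma sum_Ch_refine_le:
  fixes Li :: "nat \<Rightarrow> real \<Rightarrow> 'n::finite superop"
  assumes Li: "piecewise_continuous (Li i)" and t: "0 \<le> t" and n: "0 < n" and m: "0 < m" and l: "l \<le> m"
  shows "real (\<Sum>j=l+1..m. Ch (step_prop Li t m i j))
      + real (\<Sum>j=1..l*n. Ch (step_prop Li t (m * n) i j)) / real n
    \<le> real (N_indiv Li t i (m * n)) / real n + 2 * C_count Li t i (m * n) + 1"
proof -
  define b where "b j \<longleftrightarrow> Ch (step_prop Li t (m * n) i j) = 1" for j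
  define B where "B q \<longleftrightarrow> Ch (step_prop Li t m i q) = 1" for q
  define \<tau> where "\<tau> j = t * real j / real (m * n)" for j
  have blocks: "\<exists>j\<in>{(q - 1) * n + 1..q * n}. b j" if "q \<in> {1..m}" "B q" for q
  proof (rule ccontr)
    assume "\<not> ?thesis"
    then have ch: "quantum_channel (step_prop Li t (m * n) i j)" if "j \<in> {(q - 1) * n + 1..q * n}" for j
      using that unfolding b_def Ch_eq_1_iff by blast
    have "quantum_channel (propagator (Li i) (\<tau> (q * n)) (\<tau> ((q - 1) * n)))"
    proof (rule quantum_channel_propagator_chain[OF Li])
      show "\<tau> i \<le> \<tau> j" if "i \<le> j" for i j
        using that t by (auto simp: \<tau>_def intro!: divide_right_mono mult_left_mono)
      show "0 \<le> \<tau> ((q - 1) * n)" using t by (simp add: \<tau>_def)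
      fix j assume j: "j \<in> {(q - 1) * n + 1..q * n}"
      then have "real (j - 1) = real j - 1" by auto
      then show "quantum_channel (propagator (Li i) (\<tau> j) (\<tau> (j - 1)))"
        using ch[OF j] by (simp add: step_prop_def \<tau>_def)
    qed auto
    moreover have "\<tau> (q * n) = t * real q / real m" "\<tau> ((q - 1) * n) = t * (real q - 1) / real m"
      using n that by (auto simp: \<tau>_def)
    ultimately show False using that by (simp add: B_def Ch_def step_prop_def)
  qed
  have "n * card {q\<in>{l+1..m}. B q} \<le> card {j\<in>{l*n+1..m*n}. b j}
    + n * (2 * card {j\<in>{1..m*n-1}. \<not> b j \<and> b (Suc j)} + 1)"
    by (rule card_blocks_le[OF n m]) (use blocks in blast)
  moreover have "card {j\<in>{1..l*n}. b j} + card {j\<in>{l*n+1..m*n}. b j} = card {j\<in>{1..m*n}. b j}"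
  proof -
    have "l * n \<le> m * n" using l by (rule mult_le_mono1)
    moreover have "{1..v} = {1..u} \<union> {u+1..v}" if "u \<le> v" for u v :: nat using that by auto
    ultimately have "{1..m*n} = {1..l*n} \<union> {l*n+1..m*n}" by blast
    then have "{j\<in>{1..m*n}. b j} = {j\<in>{1..l*n}. b j} \<union> {j\<in>{l*n+1..m*n}. b j}" by blast
    then show ?thesis by (simp add: card_Un_disjoint disjoint_iff)
  qed
  ultimately have "n * card {q\<in>{l+1..m}. B q} + card {j\<in>{1..l*n}. b j} \<le> card {j\<in>{1..m*n}. b j}
      + n * (2 * card {j\<in>{1..m*n-1}. \<not> b j \<and> b (Suc j)} + 1)" by linarith
  then have "real n * card {q\<in>{l+1..m}. B q} + card {j\<in>{1..l*n}. b j} \<le> card {j\<in>{1..m*n}. b j}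
      + real n * (2 * card {j\<in>{1..m*n-1}. \<not> b j \<and> b (Suc j)} + 1)"
    by (drule_tac of_nat_mono[where 'a = real]) (simp only: of_nat_add of_nat_mult of_nat_numeral of_nat_1)
  moreover have "real (\<Sum>j=l+1..m. Ch (step_prop Li t m i j)) = card {q\<in>{l+1..m}. B q}"
    "real (\<Sum>j=1..l*n. Ch (step_prop Li t (m * n) i j)) = card {j\<in>{1..l*n}. b j}"
    "real (N_indiv Li t i (m * n)) = card {j\<in>{1..m*n}. b j}"
    by (simp_all add: sum_Ch_eq_card N_indiv_def b_def B_def)
  moreover have "C_count Li t i (m * n) = card {j\<in>{1..m*n-1}. \<not> b j \<and> b (Suc j)}"
    unfolding C_count_def b_def Ch_eq_1_iff Ch_eq_0_iff by simp
  moreover have "x + y / real n \<le> z / real n + 2 * w + 1"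
    if "real n * x + y \<le> z + real n * (2 * w + 1)" for x y z w :: real
    using divide_right_mono[OF that, of "real n"] n by (simp add: add_divide_distrib)
  ultimately show ?thesis by (simp only: of_nat_add of_nat_mult of_nat_numeral of_nat_1)
qed

text \<open>\<open>Ch\<close> acts as a 0-1 exponent: a channel contributes the factor 1, any other
  step at most exp (beta t / m).\<close>

lemma norm_1to1_trotter_step_le:
  fixes Li :: "nat \<Rightarrow> real \<Rightarrow> 'n::finite superop"
  assumes Li: "\<And>i. i \<in> {1..K} \<Longrightarrow> piecewise_continuous (Li i)" and t: "0 \<le> t" and j: "j \<in> {1..m}"
  shows "norm_1to1 (ordered_prod (\<lambda>i. step_prop Li t m i j) K)
    \<le> exp (beta K Li t * t / real m * real (\<Sum>i=1..K. Ch (step_prop Li t m i j)))"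
proof -
  have "norm_1to1 (step_prop Li t m i j) \<le> exp (beta K Li t * t / real m * real (Ch (step_prop Li t m i j)))"
    if i: "i \<in> {1..K}" for i
  proof (cases "quantum_channel (step_prop Li t m i j)")
    case True
    then show ?thesis by (simp add: Ch_def norm_1to1_quantum_channel)
  next
    case False
    have "0 \<le> t * (real j - 1) / real m" "t * (real j - 1) / real m \<le> t * real j / real m"
      using j t by (auto intro!: divide_right_mono mult_left_mono)
    moreover have "t * real j / real m \<le> t"
      using j t by (auto simp: divide_le_eq intro!: mult_left_mono)
    ultimately have "norm_1to1 (step_prop Li t m i j) \<le>
        exp (beta K Li t * (t * real j / real m - t * (real j - 1) / real m))"
      unfolding step_prop_def
      by (intro norm_1to1_propagator_le Li[OF i] norm_1to1_le_beta[OF Li i]) auto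
    also have "beta K Li t * (t * real j / real m - t * (real j - 1) / real m) = beta K Li t * t / real m"
      by (simp add: diff_divide_distrib[symmetric] algebra_simps)
    finally show ?thesis using False by (simp add: Ch_def)
  qed
  from norm_1to1_ordered_prod_le[where y = "\<lambda>i. beta K Li t * t / real m * real (Ch (step_prop Li t m i j))", OF this]
  show ?thesis by (simp add: sum_distrib_left)
qed

lemma trotter_local_error:
  fixes L :: "real \<Rightarrow> 'n::finite superop"
  assumes L: "piecewise_continuous L" and Li: "\<And>i. i \<in> {1..K} \<Longrightarrow> piecewise_continuous (Li i)"
    and sum: "\<And>s. s \<ge> 0 \<Longrightarrow> L s = (\<Sum>i=1..K. Li i s)"
    and t: "0 \<le> t" and beta: "0 \<le> beta K Li t" and j: "j \<in> {1..m}"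
  shows "norm_1to1 (propagator L (t * real j / real m) (t * (real j - 1) / real m)
      - ordered_prod (\<lambda>i. step_prop Li t m i j) K)
    \<le> (real K * (beta K Li t * t / real m))\<^sup>2 * exp (real K * (beta K Li t * t / real m))"
proof -
  have s: "0 \<le> t * (real j - 1) / real m" "t * (real j - 1) / real m \<le> t * real j / real m"
    using j t by (auto intro!: divide_right_mono mult_left_mono)
  have r: "t * real j / real m \<le> t"
    using j t by (auto simp: divide_le_eq intro!: mult_left_mono)
  have "beta K Li t * (t * real j / real m - t * (real j - 1) / real m) = beta K Li t * t / real m"
    by (simp add: diff_divide_distrib[symmetric] algebra_simps)
  moreover have "norm_1to1 (Li i x) \<le> beta K Li t"
    if "i \<in> {1..K}" "x \<in> {t * (real j - 1) / real m..t * real j / real m}" for i x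
    using that s r by (intro norm_1to1_le_beta Li) auto
  ultimately show ?thesis
    using trotter_step_error[OF L Li sum s, where c = "beta K Li t"] beta by (simp add: step_prop_def)
qed

text \<open>
  The Trotter products at level \<open>m * n\<close> converge to the propagator as \<open>n\<close> tends to infinity, so
  their norm bound, which only counts the indivisible steps, carries over to the propagator up to
  an error that vanishes in the limit.
\<close>

lemma norm_1to1_propagator_le_trotter:
  fixes L :: "real \<Rightarrow> 'n::finite superop"
  assumes L: "piecewise_continuous L" and Li: "\<And>i. i \<in> {1..K} \<Longrightarrow> piecewise_continuous (Li i)"
    and sum: "\<And>s. s \<ge> 0 \<Longrightarrow> L s = (\<Sum>i=1..K. Li i s)"
    and t: "0 \<le> t" and beta: "0 \<le> beta K Li t" and l: "l \<le> m" and m: "0 < m"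
  obtains err where "err \<longlonglongrightarrow> 0"
    "\<And>n. 0 < n \<Longrightarrow> norm_1to1 (propagator L (t * real l / real m) 0) \<le>
      exp (beta K Li t * t / real (m * n) *
        real (\<Sum>i=1..K. \<Sum>j=1..l*n. Ch (step_prop Li t (m * n) i j))) + err n"
proof
  let ?b = "beta K Li t"
  let ?c = "real K * (?b * t * real l / real m)"
  let ?d = "\<lambda>n. ?b * t / real (m * n)"
  let ?e = "\<lambda>n. (real K * ?d n)\<^sup>2 * exp (real K * ?d n)"
  \<comment> \<open>There are l n errors \<open>?e n\<close>, each with a crude factor exp
    \<open>?c\<close> on either side. As l n K \<open>?d n\<close> is the constant
    \<open>?c\<close>, one power of \<open>?d n\<close> remains and tends to 0, so the crude factors
    do no harm.\<close>
  let ?err = "\<lambda>n. exp ?c * exp ?c * (?c * (real K * ?d n) * exp (real K * ?d n))"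
  have d0: "?d \<longlonglongrightarrow> 0"
  proof -
    have "(\<lambda>n. (?b * t / real m) * inverse (real n)) \<longlonglongrightarrow> (?b * t / real m) * 0"
      by (intro tendsto_intros lim_inverse_n)
    then show ?thesis by (simp add: divide_inverse mult_ac)
  qed
  have "?err \<longlonglongrightarrow> exp ?c * exp ?c * (?c * (real K * 0) * exp (real K * 0))"
    by (intro tendsto_intros d0)
  then show "?err \<longlonglongrightarrow> 0" by simp
  fix n :: nat assume n: "0 < n"
  let ?X = "\<lambda>j. propagator L (t * real j / real (m * n)) (t * (real j - 1) / real (m * n))"
  let ?Y = "\<lambda>j. ordered_prod (\<lambda>i. step_prop Li t (m * n) i j) K"
  have ln: "l * n \<le> m * n" using l by simp
  have dn: "0 \<le> ?d n" using t beta by simp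
  have Nd: "real (l * n) * (real K * ?d n) = ?c" using n by simp
  have in_range: "j \<in> {1..m*n}" if "j \<in> {1..l*n}" for j
    using that ln unfolding atLeastAtMost_iff by linarith
  have Y: "norm_1to1 (?Y j) \<le> exp (?d n * real (\<Sum>i=1..K. Ch (step_prop Li t (m * n) i j)))"
    if "j \<in> {1..l*n}" for j
    by (intro norm_1to1_trotter_step_le Li t in_range that)
  have YK: "norm_1to1 (?Y j) \<le> exp (real K * ?d n)" if "j \<in> {1..l*n}" for j
  proof -
    have "(\<Sum>i=1..K. Ch (step_prop Li t (m * n) i j)) \<le> (\<Sum>i=1..K. 1)"
      by (intro sum_mono) (simp add: Ch_def)
    then have "(\<Sum>i=1..K. Ch (step_prop Li t (m * n) i j)) \<le> K" by simp
    then have "real (\<Sum>i=1..K. Ch (step_prop Li t (m * n) i j)) \<le> real K" by (rule of_nat_mono)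
    then have "?d n * real (\<Sum>i=1..K. Ch (step_prop Li t (m * n) i j)) \<le> ?d n * real K"
      using dn by (rule mult_left_mono)
    then show ?thesis by (intro order_trans[OF Y[OF that]]) (simp only: exp_le_cancel_iff mult.commute)
  qed
  have XY: "norm_1to1 (?X j - ?Y j) \<le> ?e n" if "j \<in> {1..l*n}" for j
    by (intro trotter_local_error L Li sum t beta in_range that)
  have X: "norm_1to1 (ordered_prod ?X q) \<le> exp ?c" if "q \<le> l * n" for q
  proof -
    let ?r = "t * real q / real (m * n)"
    have "q \<le> m * n" using that ln by linarith
    then have r: "0 \<le> ?r" "?r \<le> t" using t n m by (auto simp: divide_le_eq mult_left_mono simp del: of_nat_mult)
    have LK: "norm_1to1 (L x) \<le> real K * ?b" if "x \<in> {0..?r}" for x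
    proof -
      have "norm_1to1 (L x) \<le> (\<Sum>i=1..K. norm_1to1 (Li i x))"
        using that norm_1to1_sum[of "\<lambda>i. Li i x" "{1..K}"] by (simp add: sum)
      also have "\<dots> \<le> (\<Sum>i=1..K. ?b)"
        using that r by (intro sum_mono norm_1to1_le_beta Li) auto
      finally show ?thesis by simp
    qed
    have "norm_1to1 (propagator L ?r 0) \<le> exp (real K * ?b * (?r - 0))"
      by (rule norm_1to1_propagator_le[OF L order.refl r(1) LK])
    also have "real K * ?b * (?r - 0) = real q * (real K * ?d n)" by simp
    also have "\<dots> \<le> real (l * n) * (real K * ?d n)"
      using that dn by (intro mult_right_mono mult_nonneg_nonneg of_nat_mono) simp_all
    finally show ?thesis unfolding ordered_prod_propagator[OF L t] Nd by simp
  qed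
  have "norm_1to1 (ordered_prod ?X (l * n) - ordered_prod ?Y (l * n))
      \<le> (\<Sum>q<l*n. exp (\<Sum>i=q+2..l*n. real K * ?d n) * (?e n * norm_1to1 (ordered_prod ?X q)))"
    by (rule ordered_prod_diff_le[OF YK XY])
  also have "\<dots> \<le> (\<Sum>q<l*n. exp ?c * (?e n * exp ?c))"
  proof (intro sum_mono mult_mono)
    fix q assume q: "q \<in> {..<l*n}"
    have "(\<Sum>i=q+2..l*n. real K * ?d n) = real (l * n - Suc q) * (real K * ?d n)" by simp
    also have "\<dots> \<le> real (l * n) * (real K * ?d n)"
      using dn by (intro mult_right_mono mult_nonneg_nonneg of_nat_mono) simp_all
    finally show "exp (\<Sum>i=q+2..l*n. real K * ?d n) \<le> exp ?c" unfolding Nd by simp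
    show "norm_1to1 (ordered_prod ?X q) \<le> exp ?c" using q by (intro X) auto
  qed (auto intro: norm_1to1_nonneg mult_nonneg_nonneg)
  also have "\<dots> = exp ?c * exp ?c * ((real (l * n) * (real K * ?d n)) * (real K * ?d n) * exp (real K * ?d n))"
    by (simp add: power2_eq_square mult_ac del: of_nat_mult)
  also have "\<dots> = ?err n" unfolding Nd ..
  finally have 1: "norm_1to1 (ordered_prod ?X (l * n) - ordered_prod ?Y (l * n)) \<le> ?err n" .
  have "norm_1to1 (ordered_prod ?Y (l * n)) \<le>
      exp (\<Sum>j=1..l*n. ?d n * real (\<Sum>i=1..K. Ch (step_prop Li t (m * n) i j)))"
    by (rule norm_1to1_ordered_prod_le[OF Y])
  also have "(\<Sum>j=1..l*n. ?d n * real (\<Sum>i=1..K. Ch (step_prop Li t (m * n) i j))) =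
      ?d n * real (\<Sum>i=1..K. \<Sum>j=1..l*n. Ch (step_prop Li t (m * n) i j))"
    by (subst sum.swap) (simp only: of_nat_sum sum_distrib_left)
  finally have 2: "norm_1to1 (ordered_prod ?Y (l * n)) \<le>
      exp (?d n * real (\<Sum>i=1..K. \<Sum>j=1..l*n. Ch (step_prop Li t (m * n) i j)))" .
  have "t * real (l * n) / real (m * n) = t * real l / real m" using n by simp
  then have "ordered_prod ?X (l * n) = propagator L (t * real l / real m) 0"
    unfolding ordered_prod_propagator[OF L t] by simp
  then show "norm_1to1 (propagator L (t * real l / real m) 0) \<le>
      exp (?d n * real (\<Sum>i=1..K. \<Sum>j=1..l*n. Ch (step_prop Li t (m * n) i j))) + ?err n"
    using 1 2 norm_1to1_triangle[of "ordered_prod ?X (l * n) - ordered_prod ?Y (l * n)" "ordered_prod ?Y (l * n)"]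
    by simp
qed

text \<open>The left side does not depend on n, while the bound from the two-grid count involves the
  sequences at m n. Letting n tend to infinity replaces them by their limits, although m stays
  fixed.\<close>

lemma mixed_product_norm_le:
  fixes L :: "real \<Rightarrow> 'n::finite superop"
  assumes L: "piecewise_continuous L" and Li: "\<And>i. i \<in> {1..K} \<Longrightarrow> piecewise_continuous (Li i)"
    and sum: "\<And>s. s \<ge> 0 \<Longrightarrow> L s = (\<Sum>i=1..K. Li i s)"
    and t: "0 \<le> t" and beta: "0 \<le> beta K Li t" and l: "l < m"
    and tid: "\<And>i. i \<in> {1..K} \<Longrightarrow> t_ID_seq Li t i \<longlonglongrightarrow> T i"
    and cc: "\<And>i. i \<in> {1..K} \<Longrightarrow> C_count Li t i \<longlonglongrightarrow> C i"
  shows "exp (\<Sum>j=l+2..m. beta K Li t * t / real m * real (\<Sum>i=1..K. Ch (step_prop Li t m i j)))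
      * norm_1to1 (propagator L (t * real l / real m) 0)
    \<le> exp (\<Sum>i=1..K. beta K Li t * T i + beta K Li t * t / real m * (2 * C i + 1))"
proof -
  let ?b = "beta K Li t"
  let ?d = "?b * t / real m"
  let ?F = "\<lambda>M i j. Ch (step_prop Li t M i j)"
  let ?E = "exp (\<Sum>j=l+2..m. ?d * real (\<Sum>i=1..K. ?F m i j))"
  have m: "0 < m" using l by simp
  have d0: "0 \<le> ?d" using t beta by simp
  obtain err where err: "err \<longlonglongrightarrow> 0"
    "\<And>n. 0 < n \<Longrightarrow> norm_1to1 (propagator L (t * real l / real m) 0) \<le>
      exp (?b * t / real (m * n) * real (\<Sum>i=1..K. \<Sum>j=1..l*n. ?F (m * n) i j)) + err n"
    using norm_1to1_propagator_le_trotter[OF L Li sum t beta less_imp_le[OF l] m] by blast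
  let ?G = "\<lambda>n. exp (\<Sum>i=1..K. ?b * t_ID_seq Li t i (m * n) + ?d * (2 * C_count Li t i (m * n) + 1))"
  have step: "?E * norm_1to1 (propagator L (t * real l / real m) 0) \<le> ?G n + ?E * err n" if n: "0 < n" for n
  proof -
    have "?E * norm_1to1 (propagator L (t * real l / real m) 0) \<le>
        ?E * (exp (?b * t / real (m * n) * real (\<Sum>i=1..K. \<Sum>j=1..l*n. ?F (m * n) i j)) + err n)"
      by (intro mult_left_mono err n) auto
    moreover have "?E * exp (?b * t / real (m * n) * real (\<Sum>i=1..K. \<Sum>j=1..l*n. ?F (m * n) i j)) \<le> ?G n"
    proof -
      have "(\<Sum>j=l+2..m. ?d * real (\<Sum>i=1..K. ?F m i j)) = (\<Sum>i=1..K. ?d * real (\<Sum>j=l+2..m. ?F m i j))"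
        by (simp only: of_nat_sum sum_distrib_left) (rule sum.swap)
      moreover have "?b * t / real (m * n) * real (\<Sum>i=1..K. \<Sum>j=1..l*n. ?F (m * n) i j)
          = (\<Sum>i=1..K. ?d * (real (\<Sum>j=1..l*n. ?F (m * n) i j) / real n))"
        by (simp add: sum_distrib_left sum_divide_distrib)
      moreover have "?d * real (\<Sum>j=l+2..m. ?F m i j) + ?d * (real (\<Sum>j=1..l*n. ?F (m * n) i j) / real n)
          \<le> ?b * t_ID_seq Li t i (m * n) + ?d * (2 * C_count Li t i (m * n) + 1)" if i: "i \<in> {1..K}" for i
      proof -
        \<comment> \<open>Restoring the exchanged step l + 1 only increases the count and closes the
          gap between the two ranges.\<close>
        have "(\<Sum>j=l+2..m. ?F m i j) \<le> (\<Sum>j=l+1..m. ?F m i j)" by (intro sum_mono2) auto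
        then have "real (\<Sum>j=l+2..m. ?F m i j) \<le> real (\<Sum>j=l+1..m. ?F m i j)" by (rule of_nat_mono)
        then have "real (\<Sum>j=l+2..m. ?F m i j) + real (\<Sum>j=1..l*n. ?F (m * n) i j) / real n \<le>
            real (N_indiv Li t i (m * n)) / real n + 2 * C_count Li t i (m * n) + 1"
          using sum_Ch_refine_le[where Li = Li and i = i, OF Li[OF i] t n m less_imp_le[OF l]] by linarith
        then have "?d * (real (\<Sum>j=l+2..m. ?F m i j) + real (\<Sum>j=1..l*n. ?F (m * n) i j) / real n) \<le>
            ?d * (real (N_indiv Li t i (m * n)) / real n + 2 * C_count Li t i (m * n) + 1)"
          using d0 by (rule mult_left_mono)
        moreover have "?d * (real (N_indiv Li t i (m * n)) / real n) = ?b * t_ID_seq Li t i (m * n)"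
          by (simp add: t_ID_seq_def)
        ultimately show ?thesis by (simp only: distrib_left)
      qed
      ultimately show ?thesis
        by (simp only: exp_add[symmetric] sum.distrib[symmetric] exp_le_cancel_iff) (intro sum_mono, blast)
    qed
    ultimately show ?thesis by (simp only: distrib_left)
  qed
  \<comment> \<open>The multiples of m form a subsequence, with the same limits; m > 0 makes it
    strictly increasing.\<close>
  have sub: "(\<lambda>n. s (m * n)) \<longlonglongrightarrow> a" if "s \<longlonglongrightarrow> a" for s :: "nat \<Rightarrow> real" and a
    using LIMSEQ_subseq_LIMSEQ[OF that, of "\<lambda>n. m * n"] m by (simp add: o_def strict_mono_def)
  have "(\<lambda>n. ?G n + ?E * err n) \<longlonglongrightarrow>
      exp (\<Sum>i=1..K. ?b * T i + ?d * (2 * C i + 1)) + ?E * 0"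
    by (intro tendsto_intros err sub tid cc)
  then have "(\<lambda>n. ?G n + ?E * err n) \<longlonglongrightarrow> exp (\<Sum>i=1..K. ?b * T i + ?d * (2 * C i + 1))" by simp
  then show ?thesis
    by (rule LIMSEQ_le_const) (use step in \<open>auto intro!: exI[of _ 1]\<close>)
qed

theorem corollary1p1:
  fixes L :: "real \<Rightarrow> ('x::finite \<Rightarrow> 'd::finite) superop"
    and Li :: "nat \<Rightarrow> real \<Rightarrow> ('x \<Rightarrow> 'd) superop"
    and t \<epsilon> :: real
    and k K m :: nat
  assumes "piecewise_continuous L"
    and "\<And>i. i \<in> {1..K} \<Longrightarrow> piecewise_continuous (Li i)"
    and "\<And>i. i \<in> {1..K} \<Longrightarrow> strictly_local k (Li i)"
    and "\<And>s. s \<ge> 0 \<Longrightarrow> L s = (\<Sum>i=1..K. Li i s)"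
    and "1 \<le> K" and "K \<le> CARD('x) ^ k"
    and "t \<ge> 0"
    and "\<And>i. i \<in> {1..K} \<Longrightarrow> convergent (t_ID_seq Li t i)"
    and "\<And>i. i \<in> {1..K} \<Longrightarrow> convergent (C_count Li t i)"
    and "0 < \<epsilon>"
    and "\<epsilon> \<le> 2 * real K ^ 2 * beta K Li t * t * ln 2
               * exp ((real K + real K ^ 2) * t_ID K Li t * beta K Li t)
             / (3 + (3 + C_tilde K Li t) * real K + C_tilde K Li t * real K ^ 2)"
    and "0 < m"
    and "real m \<ge> 2 * real K ^ 2 * (beta K Li t) ^ 2 * t ^ 2
               * exp ((real K + real K ^ 2) * t_ID K Li t * beta K Li t) / \<epsilon>"
  shows "norm_1to1 (propagator L t 0
           - ordered_prod (\<lambda>j. ordered_prod (\<lambda>i. step_prop Li t m i j) K) m) \<le> \<epsilon>"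
proof -
  note L = assms(1) and Li = assms(2) and sum = assms(4) and K = assms(5) and t = assms(7)
    and m = assms(12)
  let ?b = "beta K Li t" and ?T = "t_ID K Li t" and ?C = "C_tilde K Li t"
  let ?Ti = "\<lambda>i. lim (t_ID_seq Li t i)" and ?Ci = "\<lambda>i. lim (C_count Li t i)"
  define \<delta> where "\<delta> = ?b * t / real m"
  define E where "E = exp ((real K + (real K)\<^sup>2) * ?T * ?b)"
  define D where "D = 3 + (3 + ?C) * real K + ?C * (real K)\<^sup>2"
  have tid: "t_ID_seq Li t i \<longlonglongrightarrow> ?Ti i" and cc: "C_count Li t i \<longlonglongrightarrow> ?Ci i" if "i \<in> {1..K}" for i
    using assms(8,9) that by (simp_all add: convergent_LIMSEQ_iff)
  have T: "?Ti i \<le> ?T" and C: "2 * ?Ci i \<le> ?C" if "i \<in> {1..K}" for i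
    using that unfolding t_ID_def C_tilde_def by (auto intro!: Max_ge)
  have 1: "1 \<in> {1..K}" using K by simp
  have "0 \<le> ?Ti 1" by (rule LIMSEQ_le_const[OF tid[OF 1]]) (use t in \<open>simp add: t_ID_seq_def\<close>)
  then have T0: "0 \<le> ?T" using T[OF 1] by linarith
  have "0 \<le> ?Ci 1" by (rule LIMSEQ_le_const[OF cc[OF 1]]) (simp add: C_count_def)
  then have C0: "0 \<le> ?C" using C[OF 1] by linarith
  have b0: "0 \<le> ?b"
    using norm_1to1_le_beta[where Li = Li and s = 0 and t = t, OF Li 1] t norm_1to1_nonneg[of "Li 1 0"] by auto
  have D: "0 < D" using C0 by (simp add: D_def add_pos_nonneg)
  \<comment> \<open>A positive \<epsilon> below the bound excludes beta t = 0, so beta t can be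
    cancelled later.\<close>
  have "0 < 2 * (real K)\<^sup>2 * ?b * t * ln 2 * E / D"
    using assms(10,11) unfolding D_def E_def by linarith
  then have "?b * t \<noteq> 0" by auto
  then have bt: "0 < ?b * t" using mult_nonneg_nonneg[OF b0 t] by linarith
  have \<delta>: "0 \<le> \<delta>" using b0 t by (simp add: \<delta>_def)
  have me: "2 * (real K)\<^sup>2 * (?b * t)\<^sup>2 * E \<le> real m * \<epsilon>"
    using assms(10,13) by (simp add: E_def divide_le_eq power_mult_distrib mult.assoc)
  \<comment> \<open>The lower bound on m and the upper bound on \<epsilon> are chained through m
    \<epsilon>; cancelling 2 K^2 beta t E leaves beta t \<le> m ln 2 / D, that is, D \<delta> \<le>
    ln 2.\<close>
  have "real m * \<epsilon> \<le> real m * (2 * (real K)\<^sup>2 * (?b * t) * ln 2 * E / D)"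
    using assms(11) by (intro mult_left_mono) (auto simp: E_def D_def mult.assoc)
  with me have "(2 * (real K)\<^sup>2 * (?b * t) * E) * (?b * t) \<le> (2 * (real K)\<^sup>2 * (?b * t) * E) * (real m * ln 2 / D)"
    by (simp add: power2_eq_square mult_ac)
  moreover have "0 < 2 * (real K)\<^sup>2 * (?b * t) * E" using bt K by (simp add: E_def)
  ultimately have "?b * t \<le> real m * ln 2 / D" by (rule mult_left_le_imp_le)
  then have D\<delta>: "D * \<delta> \<le> ln 2" using D m by (simp add: \<delta>_def field_simps)
  define e where "e = (real K * \<delta>)\<^sup>2 * exp (real K * \<delta>)"
  \<comment> \<open>K copies of the exponent from \<open>mixed_product_norm_le\<close>, with the
    maxima over i inserted; the factor 2 of \<open>C_tilde\<close> absorbs 2 C_i.\<close>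
  define G where "G = exp (real K * (?b * ?T + \<delta> * (?C + 1)))"
  let ?X = "\<lambda>j. propagator L (t * real j / real m) (t * (real j - 1) / real m)"
  let ?Y = "\<lambda>j. ordered_prod (\<lambda>i. step_prop Li t m i j) K"
  have "norm_1to1 (ordered_prod ?X m - ordered_prod ?Y m) \<le>
      (\<Sum>l<m. exp (\<Sum>j=l+2..m. \<delta> * real (\<Sum>i=1..K. Ch (step_prop Li t m i j)))
        * (e * norm_1to1 (ordered_prod ?X l)))"
    unfolding e_def \<delta>_def
    by (intro ordered_prod_diff_le norm_1to1_trotter_step_le trotter_local_error L Li sum t b0)
  also have "\<dots> \<le> (\<Sum>l<m. e * G)"
  proof (rule sum_mono)
    fix l assume "l \<in> {..<m}"
    then have l: "l < m" by simp
    have "exp (\<Sum>j=l+2..m. \<delta> * real (\<Sum>i=1..K. Ch (step_prop Li t m i j)))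
        * norm_1to1 (propagator L (t * real l / real m) 0)
      \<le> exp (\<Sum>i=1..K. ?b * ?Ti i + \<delta> * (2 * ?Ci i + 1))"
      unfolding \<delta>_def by (rule mixed_product_norm_le[OF L Li sum t b0 l tid cc])
    also have "(\<Sum>i=1..K. ?b * ?Ti i + \<delta> * (2 * ?Ci i + 1)) \<le> (\<Sum>i=1..K. ?b * ?T + \<delta> * (?C + 1))"
      by (intro sum_mono add_mono mult_left_mono T b0 \<delta> add_right_mono C)
    finally have "exp (\<Sum>j=l+2..m. \<delta> * real (\<Sum>i=1..K. Ch (step_prop Li t m i j)))
        * norm_1to1 (propagator L (t * real l / real m) 0) \<le> G"
      by (simp add: G_def)
    then have "e * (exp (\<Sum>j=l+2..m. \<delta> * real (\<Sum>i=1..K. Ch (step_prop Li t m i j)))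
        * norm_1to1 (propagator L (t * real l / real m) 0)) \<le> e * G"
      by (rule mult_left_mono) (simp add: e_def)
    then show "exp (\<Sum>j=l+2..m. \<delta> * real (\<Sum>i=1..K. Ch (step_prop Li t m i j)))
        * (e * norm_1to1 (ordered_prod ?X l)) \<le> e * G"
      unfolding ordered_prod_propagator[OF L t] by (simp only: mult_ac)
  qed
  \<comment> \<open>The exponent K \<delta> of the local error joins K \<delta> (C + 1) from
    \<open>G\<close>, which gives K (C + 2) \<delta>.\<close>
  also have "\<dots> = real m * (real K)\<^sup>2 * \<delta>\<^sup>2 * (exp (real K * ?b * ?T) * exp (real K * (?C + 2) * \<delta>))"
    by (simp add: e_def G_def power_mult_distrib exp_add[symmetric] mult_ac) (simp add: algebra_simps)
  \<comment> \<open>E absorbs the part with the indivisible time, since K \<le> K + K^2; the part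
    proportional to \<delta> is at most exp (ln 2) = 2.\<close>
  also have "\<dots> \<le> real m * (real K)\<^sup>2 * \<delta>\<^sup>2 * (E * 2)"
  proof (intro mult_left_mono mult_mono)
    show "exp (real K * ?b * ?T) \<le> E"
      using mult_right_mono[of "real K" "real K + (real K)\<^sup>2" "?T * ?b"] T0 b0
      unfolding E_def by (simp add: mult_ac)
    have "real K * (?C + 2) \<le> D" using C0 by (simp add: D_def algebra_simps)
    then have "real K * (?C + 2) * \<delta> \<le> ln 2"
      using D\<delta> mult_right_mono[OF _ \<delta>] order_trans by blast
    then show "exp (real K * (?C + 2) * \<delta>) \<le> 2"
      using exp_le_cancel_iff[of "real K * (?C + 2) * \<delta>" "ln 2"] by simp
  qed (auto simp: E_def)
  also have "\<dots> = 2 * (real K)\<^sup>2 * (?b * t)\<^sup>2 * E / real m"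
    using m by (simp add: \<delta>_def power2_eq_square)
  also have "\<dots> \<le> \<epsilon>" using me m by (simp add: divide_le_eq mult.commute)
  finally show ?thesis
    unfolding ordered_prod_propagator[OF L t] using m by simp
qed

end
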